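(* Let $p,q,m,r$ be nonnegative integers. Then the following three quantities (A), (B), (C) are equal: (A) $$\sum_{\substack{\boldsymbol{\alpha}\in\mathbb{N}^{r+1}\\ |\boldsymbol{\alpha}|=q+r+1}}\ \sum_{1\le k_1<k_2<\cdots<k_{p+r+1}}\frac{(k_1k_2\cdots k_p\, k_{p+r+1})^{-1}}{(k_{p+1}+m)^{\alpha_1}(k_{p+2}+m)^{\alpha_2}\cdots (k_{p+r+1}+m)^{\alpha_{r+1}}};$$ (B) $$\sum_{\substack{\boldsymbol{\beta}\in\mathbb{N}^{p+1}\\ |\boldsymbol{\beta}|=p+r+1}}\ \sum_{1\le \ell_1<\ell_2<\cdots<\ell_{p+1}} \ell_1^{-\beta_1}\ell_2^{-\beta_2}\cdots \ell_{p+1}^{-\beta_{p+1}}(\ell_{p+1}+m)^{-q-1};$$ (C) $$\sum_{j=0}^m (-1)^j \binom{m}{j} \sum_{\substack{\boldsymbol{\beta}\in\mathbb{N}^{r+1}\\ |\boldsymbol{\beta}|=p+r+1}}\ \sum_{1\le \ell_1<\ell_2<\cdots<\ell_{q+r+1}}(\ell_1\ell_2\cdots \ell_q)^{-1}(\ell_{q+1}+j)^{-\beta_1}(\ell_{q+2}+j)^{-\beta_2}\cdots(\ell_{q+r}+j)^{-\beta_{r}} (\ell_{q+r+1}+j)^{-\beta_{r+1}-1}.$$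
   Context: $\mathbb{N}$ denotes the set of positive integers. For a tuple $\boldsymbol{\alpha}=(\alpha_1,\ldots,\alpha_n)$ of positive integers, $|\boldsymbol{\alpha}|=\alpha_1+\cdots+\alpha_n$. Sums over $1\le k_1<\cdots<k_n$ (or $1\le \ell_1<\cdots<\ell_n$) run over all strictly increasing $n$-tuples of positive integers. Empty products equal $1$: in (A), when $p=0$ the product $k_1\cdots k_p$ is $1$; in (C), when $q=0$ the product $\ell_1\cdots\ell_q$ is $1$, and when $r=0$ the only shifted factor is $(\ell_{q+1}+j)^{-\beta_1-1}$. *)

theory Defs
  imports "HOL-Analysis.Analysis"
begin

text \<open>An \<open>n\<close>-tuple \<open>(x\<^sub>1, \<dots>, x\<^sub>n)\<close> of positive integers is an extensional function on \<open>{1..n}\<close>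
  (value \<open>undefined\<close> outside \<open>{1..n}\<close>), so that each tuple is represented exactly once.\<close>

definition compositions :: "nat \<Rightarrow> nat \<Rightarrow> (nat \<Rightarrow> nat) set" where
  "compositions n w = {\<alpha> \<in> {1..n} \<rightarrow>\<^sub>E {1..}. (\<Sum>i=1..n. \<alpha> i) = w}"

definition increasing_tuples :: "nat \<Rightarrow> (nat \<Rightarrow> nat) set" where
  "increasing_tuples n = {k \<in> {1..n} \<rightarrow>\<^sub>E {1..}. strict_mono_on {1..n} k}"

definition summand_A :: "nat \<Rightarrow> nat \<Rightarrow> nat \<Rightarrow> (nat \<Rightarrow> nat) \<Rightarrow> (nat \<Rightarrow> nat) \<Rightarrow> real" where
  "summand_A p m r \<alpha> k =
     inverse ((\<Prod>i=1..p. real (k i)) * real (k (p + r + 1)))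
       / (\<Prod>i=1..r+1. real (k (p + i) + m) ^ \<alpha> i)"

definition summand_B :: "nat \<Rightarrow> nat \<Rightarrow> nat \<Rightarrow> (nat \<Rightarrow> nat) \<Rightarrow> (nat \<Rightarrow> nat) \<Rightarrow> real" where
  "summand_B p q m \<beta> l =
     (\<Prod>i=1..p+1. inverse (real (l i) ^ \<beta> i)) * inverse (real (l (p + 1) + m) ^ (q + 1))"

definition summand_C :: "nat \<Rightarrow> nat \<Rightarrow> nat \<Rightarrow> (nat \<Rightarrow> nat) \<Rightarrow> (nat \<Rightarrow> nat) \<Rightarrow> real" where
  "summand_C q r j \<beta> l =
     inverse (\<Prod>i=1..q. real (l i))
       * (\<Prod>i=1..r. inverse (real (l (q + i) + j) ^ \<beta> i))
       * inverse (real (l (q + r + 1) + j) ^ (\<beta> (r + 1) + 1))"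

end

theory Submission
  imports Defs
begin

text \<open>
  Write \<open>R\<^sub>m\<^sub>,\<^sub>r(a)\<close> for the part of (A) carried by the last \<open>r + 1\<close> indices, all of them being \<open>> a\<close>,
  as a power series in a variable \<open>X\<close> marking \<open>q\<close>; summing over the compositions turns each factor
  into \<open>1 / (k + m - X)\<close>. Let \<open>T f (a) = (\<Sum>v>a. f v / v)\<close>. Then (A) is the coefficient of \<open>X^q\<close> in
  \<open>T^p R\<^sub>m\<^sub>,\<^sub>r (0)\<close>, and the inner sum of (C) is the coefficient of \<open>X^p\<close> in \<open>T^q (R\<^sub>0\<^sub>,\<^sub>r(\<cdot> + j)) (0)\<close>.
  The family \<open>R\<close> is characterised by \<open>(a + m - X) (R\<^sub>m\<^sub>,\<^sub>r(a-1) - R\<^sub>m\<^sub>,\<^sub>r(a)) = R\<^sub>m\<^sub>,\<^sub>r\<^sub>-\<^sub>1(a)\<close> (with \<open>1/a\<close> on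
  the right if \<open>r = 0\<close>) and by vanishing at infinity, and two series over \<open>l\<close> satisfy this by
  telescoping: one whose dependence on \<open>a\<close> is \<open>\<Prod>i\<le>a. (l - i) / (l - i - z)\<close>, with \<open>z\<close> marking \<open>r\<close>,
  and, for \<open>m = 0\<close>, one whose dependence on \<open>a\<close> is the Beta value \<open>B(a+1, l)\<close>. On the first kernel
  \<open>T^p\<close> at \<open>0\<close> produces \<open>\<Sum>l\<^sub>1<\<dots><l\<^sub>p<l. \<Prod>i. 1 / (l\<^sub>i - z)\<close>, which gives (B). The alternating binomial
  sum over \<open>j\<close> turns the second kernel into \<open>B(a+1, l+m)\<close>, of which \<open>1 / (l + m)\<close> times itself is the image
  under \<open>T\<close>; evaluating \<open>T^q\<close> at \<open>0\<close> gives (B) again.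
\<close>

unbundle no vec_syntax and fps_syntax

subsection \<open>Geometric power series\<close>

definition nonneg_fps :: "real fps \<Rightarrow> bool" where
  "nonneg_fps f \<longleftrightarrow> (\<forall>n. 0 \<le> f $ n)"

lemma nonneg_fpsD: "nonneg_fps f \<Longrightarrow> 0 \<le> f $ n"
  by (simp add: nonneg_fps_def)

lemma nonneg_fps_const: "0 \<le> c \<Longrightarrow> nonneg_fps (fps_const c)"
  by (simp add: nonneg_fps_def)

lemma nonneg_fps_1: "nonneg_fps 1"
  by (simp add: nonneg_fps_def)

lemma nonneg_fps_mult: "nonneg_fps f \<Longrightarrow> nonneg_fps g \<Longrightarrow> nonneg_fps (f * g)"
  by (simp add: nonneg_fps_def fps_mult_nth sum_nonneg)

lemma nonneg_fps_sum: "(\<And>i. i \<in> I \<Longrightarrow> nonneg_fps (f i)) \<Longrightarrow> nonneg_fps (\<Sum>i\<in>I. f i)"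
  by (simp add: nonneg_fps_def fps_sum_nth sum_nonneg)

lemma nonneg_fps_prod: "(\<And>i. i \<in> I \<Longrightarrow> nonneg_fps (f i)) \<Longrightarrow> nonneg_fps (\<Prod>i\<in>I. f i)"
  by (induction I rule: infinite_finite_induct) (auto simp: nonneg_fps_1 intro: nonneg_fps_mult)

text \<open>The expansion of \<open>1 / (n - X)\<close>; the junk value \<open>geo 0 = 0\<close> lets sums start at \<open>0\<close>.\<close>

definition geo :: "nat \<Rightarrow> real fps" where
  "geo n = Abs_fps (\<lambda>s. inverse (real n) ^ (s + 1))"

lemma geo_nth: "geo n $ s = inverse (real n) ^ (s + 1)"
  by (simp add: geo_def)

lemma geo_0 [simp]: "geo 0 = 0"
  by (simp add: fps_eq_iff geo_nth)

lemma nonneg_geo: "nonneg_fps (geo n)"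
  by (simp add: nonneg_fps_def geo_nth)

lemma geo_const: "n > 0 \<Longrightarrow> fps_const (real n) * geo n = 1 + fps_X * geo n"
proof (rule fps_ext)
  fix s assume "n > 0"
  then show "(fps_const (real n) * geo n) $ s = (1 + fps_X * geo n) $ s"
    by (cases s) (simp_all add: geo_nth)
qed

lemma geo_mult_left: "n > 0 \<Longrightarrow> (fps_const (real n) - fps_X) * geo n = 1"
  using geo_const[of n] by (simp add: algebra_simps)

lemma geo_nth_le: "v \<le> n \<Longrightarrow> v > 0 \<Longrightarrow> geo n $ s \<le> inverse (real v)"
proof -
  assume *: "v \<le> n" "v > 0"
  have "geo n $ s \<le> inverse (real n) ^ 1"
    unfolding geo_nth using * by (intro power_decreasing) (auto simp: field_simps)
  also have "\<dots> \<le> inverse (real v)"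
    using * by (simp add: field_simps)
  finally show ?thesis .
qed

subsection \<open>The rational kernel\<close>

text \<open>The product of (l - i)/(l - i - z), with \<open>fps_X\<close> in the role of z. The
  subtraction inside \<open>geo\<close> truncates harmlessly: the factor at i = l is zero, and
  \<open>geo 0 = 0\<close> kills all later ones.\<close>

definition kern :: "nat \<Rightarrow> nat \<Rightarrow> real fps" where
  "kern l a = (\<Prod>i=1..a. fps_const (real l - real i) * geo (l - i))"

lemma kern_0 [simp]: "kern l 0 = 1"
  by (simp add: kern_def)

lemma kern_Suc: "kern l (Suc a) = kern l a * (fps_const (real l - real (Suc a)) * geo (l - Suc a))"
  by (simp add: kern_def)

lemma kern_eq_0: "l \<le> a \<Longrightarrow> 0 < l \<Longrightarrow> kern l a = 0"
  unfolding kern_def by (intro prod_zero) (auto intro!: bexI[of _ l])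

text \<open>The factor \<open>geo l\<close> removes the one exception to the vanishing, the empty
  product \<open>kern 0 0 = 1\<close>.\<close>

lemma geo_kern_eq_0: "l \<le> a \<Longrightarrow> geo l * kern l a = 0"
  using kern_eq_0[of l a] by (cases "l = 0") auto

lemma nonneg_kern: "nonneg_fps (kern l a)"
proof (cases "l \<le> a")
  case True
  then show ?thesis
  proof (cases "l = 0")
    case True
    then show ?thesis by (cases a) (auto simp: kern_Suc nonneg_fps_1, simp add: nonneg_fps_def)
  next
    case False
    then show ?thesis using True by (simp add: kern_eq_0 nonneg_fps_def)
  qed
next
  case False
  then show ?thesis unfolding kern_def
    by (intro nonneg_fps_prod nonneg_fps_mult nonneg_fps_const nonneg_geo) auto
qed

lemma kern_Suc_left: "kern (Suc l) (Suc a) = fps_const (real l) * geo l * kern l a"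
  unfolding kern_def
  by (subst prod.atLeast_Suc_atMost) (simp_all add: prod.shift_bounds_cl_Suc_ivl del: prod.cl_ivl_Suc)

text \<open>Both sides equal - d X / ((l - X)(n - X)); this is the rational identity behind
  \<open>kern_diff\<close>.\<close>

lemma geo_identity:
  assumes "l = n + d" "0 < n"
  shows "fps_const (real l) * geo l - fps_const (real n) * geo n
    = fps_const (real d) * geo l * (1 - fps_const (real n) * geo n)"
proof -
  have "geo l - geo n = (fps_const (real n) - fps_X) * geo n * geo l
      - (fps_const (real l) - fps_X) * geo l * geo n"
    using geo_mult_left[of l] geo_mult_left[of n] assms by simp
  also have "\<dots> = - fps_const (real d) * geo l * geo n"
    using assms by (simp add: algebra_simps flip: fps_const_add fps_const_neg)
  finally have "geo l - geo n = - fps_const (real d) * geo l * geo n" .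
  then have "fps_X * (geo l - geo n) = fps_X * (- fps_const (real d) * geo l * geo n)"
    by (rule arg_cong)
  then show ?thesis
    using geo_const[of l] geo_const[of n] assms
    by (simp add: right_diff_distrib mult_ac flip: fps_const_neg)
qed

text \<open>Exchanges a difference in \<open>l\<close> for a difference in \<open>a\<close>. Both
  kernels on the left are multiples of \<open>kern l a\<close>, by \<open>kern_Suc_left\<close> and
  \<open>kern_Suc\<close>. A sum over \<open>l\<close> telescopes on the left, a sum over
  \<open>a\<close> on the right; both are used.\<close>

lemma kern_diff:
  "kern (Suc l) (Suc a) - kern l (Suc a) = fps_const (real (Suc a)) * geo l * (kern l a - kern l (Suc a))"
proof -
  \<comment> \<open>Only the last case has \<open>l - Suc a\<close> positive and needs
    \<open>geo_identity\<close>; in the other three \<open>kern l (Suc a)\<close> vanishes.\<close>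
  consider "l = 0" | "0 < l" "l \<le> a" | "l = Suc a" | n where "l = n + Suc a" "0 < n"
    by (metis add.commute less_imp_add_positive linorder_neqE_nat not_less_eq_eq not_less gr0I)
  then show ?thesis
  proof cases
    case 4
    have k: "kern l (Suc a) = fps_const (real n) * geo n * kern l a"
      by (simp add: kern_Suc 4 mult_ac)
    have "kern (Suc l) (Suc a) - kern l (Suc a) =
       (fps_const (real l) * geo l - fps_const (real n) * geo n) * kern l a"
      unfolding kern_Suc_left k by (simp only: left_diff_distrib)
    also have "\<dots> = fps_const (real (Suc a)) * geo l * (1 - fps_const (real n) * geo n) * kern l a"
      unfolding geo_identity[OF 4] ..
    finally show ?thesis unfolding k by (simp only: left_diff_distrib right_diff_distrib mult_1 mult.assoc)
  next
    case 3
    then have "kern l (Suc a) = 0" by (simp add: kern_eq_0)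
    then show ?thesis unfolding kern_Suc_left by (simp add: 3)
  next
    case 1
    then show ?thesis unfolding kern_Suc_left by (simp add: kern_Suc)
  next
    case 2
    then show ?thesis unfolding kern_Suc_left by (simp add: kern_eq_0)
  qed
qed

lemma kern_step:
  assumes "l = n + Suc a" "0 < n"
  shows "kern l (Suc a) = kern l a + fps_X * (geo n * kern l a)"
proof -
  have "kern l (Suc a) = (fps_const (real n) * geo n) * kern l a"
    using assms by (simp add: kern_Suc mult_ac)
  then show ?thesis
    unfolding geo_const[OF assms(2)] by (simp add: algebra_simps)
qed

text \<open>The last factor of the kernel, cleared of its denominator: (l - a - 1 - z) times the new
  kernel is (l - a - 1) times the old one. The multiplication by z is what later lowers
  \<open>r\<close> by one.\<close>

lemma geo_kern_step:
  "fps_const (real l - real (Suc a)) * (geo l * kern l (Suc a) - geo l * kern l a)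
    = fps_X * (geo l * kern l (Suc a))"
proof (cases "l \<le> Suc a")
  case True
  then have "geo l * kern l (Suc a) = 0" "l = Suc a \<or> geo l * kern l a = 0"
    using geo_kern_eq_0[of l] by (auto simp: le_Suc_eq)
  then show ?thesis by auto
next
  case False
  define n where "n = l - Suc a"
  have n: "l = n + Suc a" "0 < n" using False by (auto simp: n_def)
  have "kern l (Suc a) = fps_const (real n) * geo n * kern l a"
    using n by (simp add: kern_Suc mult_ac)
  then have 1: "fps_X * (geo l * kern l (Suc a)) = fps_const (real n) * (geo l * (fps_X * (geo n * kern l a)))"
    by (simp add: mult_ac)
  show ?thesis
    unfolding 1 unfolding kern_step[OF n] using n by (simp add: algebra_simps)
qed

text \<open>Bounds n^(-3/2) by a telescoping difference. With x and y the two square roots, (y -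
  x)(y + x) = 1 reduces the claim to y (x + y) \<le> 4 x^2, which follows from y \<le> 2 x.\<close>

lemma sqrt_gap:
  assumes "0 < n"
  shows "1 / (real n * sqrt (real n)) \<le> 4 / sqrt (real n) - 4 / sqrt (real (Suc n))"
proof -
  obtain x y where x: "x = sqrt (real n)" and y: "y = sqrt (real (Suc n))" by blast
  have pos: "0 < x" "0 < y" and sq: "x * x = real n" "y * y = x * x + 1"
    using assms by (simp_all add: x y)
  have yy: "y * y \<le> 2 * (x * x)" using sq assms by simp
  also have "\<dots> \<le> (2 * x) * (2 * x)" by simp
  finally have "y\<^sup>2 \<le> (2 * x)\<^sup>2" by (simp only: power2_eq_square)
  then have "y \<le> 2 * x" using pos by (intro power2_le_imp_le[of y "2 * x"]) simp_all
  then have "y * x \<le> 2 * x * x" using pos by (intro mult_right_mono) auto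
  with yy have "y * (x + y) \<le> 4 * (x * x)" by (simp only: distrib_left)
  then have "y * (x + y) * (y - x) \<le> 4 * (x * x) * (y - x)"
    using pos sq by (intro mult_right_mono) (auto simp: x y)
  moreover have "y * (x + y) * (y - x) = y"
    using sq(2) by (simp add: algebra_simps)
  ultimately have "y / (y * (x * x * x)) \<le> 4 * (x * x) * (y - x) / (y * (x * x * x))"
    using pos by (intro divide_right_mono) auto
  then have "1 / (x * x * x) \<le> 4 / x - 4 / y"
    using pos by (simp add: field_simps)
  then show ?thesis by (simp only: sq flip: x y)
qed

text \<open>Induction on \<open>r\<close>, then on \<open>a\<close>. By \<open>kern_step\<close>,
  passing from \<open>a\<close> to a + 1 adds at most a multiple of n^(-3/2) with n = l - a - 1, and
  \<open>sqrt_gap\<close> bounds this by exactly the increase of the right-hand side.\<close>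

lemma kern_nth_le:
  "a < l \<Longrightarrow> kern l a $ r \<le> 4 ^ r * (sqrt (real l) / sqrt (real (l - a)))"
proof (induction r arbitrary: a)
  case 0
  then have "kern l a $ 0 = 1"
    by (induction a) (auto simp: kern_Suc geo_nth of_nat_diff)
  with 0 show ?case by simp
next
  case (Suc r)
  note IH = Suc.IH
  show ?case using Suc.prems
  proof (induction a)
    case 0
    then show ?case by simp
  next
    case (Suc a)
    define n where "n = l - Suc a"
    have n: "l = n + Suc a" "0 < n" using Suc.prems by (auto simp: n_def)
    have *: "kern l (Suc a) = fps_const (real n) * (geo n * kern l a)"
      using n by (simp add: kern_Suc mult_ac)
    have "kern l (Suc a) $ Suc r = kern l a $ Suc r + (geo n * kern l a) $ r"
      by (simp add: kern_step[OF n])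
    \<comment> \<open>Written through \<open>kern l (Suc a)\<close>, so that the outer hypothesis
      for \<open>r\<close> applies at \<open>Suc a\<close> and no Cauchy product has to be
      estimated.\<close>
    also have "(geo n * kern l a) $ r = kern l (Suc a) $ r / real n"
      using n(2) by (simp add: * del: of_nat_add)
    also have "\<dots> \<le> 4 ^ r * (sqrt (real l) / sqrt (real n)) / real n"
      using IH[of "Suc a"] n by (intro divide_right_mono) auto
    also have "\<dots> = 4 ^ r * sqrt (real l) * (1 / (real n * sqrt (real n)))"
      by simp
    also have "\<dots> \<le> 4 ^ r * sqrt (real l) * (4 / sqrt (real n) - 4 / sqrt (real (Suc n)))"
      using n by (intro mult_left_mono sqrt_gap) auto
    also have "kern l a $ Suc r \<le> 4 ^ Suc r * (sqrt (real l) / sqrt (real (Suc n)))"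
      using Suc n by simp
    finally show ?case using n by (simp add: algebra_simps n_def[symmetric])
  qed
qed

text \<open>Uniform in \<open>a\<close>, since l - a \<ge> 1 whenever the kernel is nonzero.
  Together with \<open>geo (l + m) $ q\<close> \<le> 1/l this leaves terms of size l^(-3/2), which
  are summable.\<close>

lemma geo_kern_nth_le:
  "(geo l * kern l a) $ r \<le> (real r + 1) * 4 ^ r / sqrt (real l)"
proof (cases "a < l")
  case True
  have "(geo l * kern l a) $ r = (\<Sum>i=0..r. geo l $ i * kern l a $ (r - i))"
    by (simp add: fps_mult_nth)
  also have "\<dots> \<le> (\<Sum>i=0..r. inverse (real l) * (4 ^ r * sqrt (real l)))"
  proof (intro sum_mono mult_mono)
    fix i assume "i \<in> {0..r}"
    have "kern l a $ (r - i) \<le> 4 ^ (r - i) * (sqrt (real l) / sqrt (real (l - a)))"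
      using True by (rule kern_nth_le)
    also have "\<dots> \<le> 4 ^ r * (sqrt (real l) / 1)"
      using True by (intro mult_mono power_increasing divide_left_mono) auto
    finally show "kern l a $ (r - i) \<le> 4 ^ r * sqrt (real l)" by simp
  qed (use True in \<open>auto intro: geo_nth_le nonneg_fpsD nonneg_kern\<close>)
  also have "\<dots> = (real r + 1) * 4 ^ r * (sqrt (real l) / real l)"
    by (simp add: field_simps)
  also have "sqrt (real l) / real l = 1 / sqrt (real l)"
    using True real_div_sqrt[of "real l"] by (simp add: divide_simps)
  finally show ?thesis by simp
qed (simp add: geo_kern_eq_0)

subsection \<open>Nested sums of geometric series\<close>

text \<open>The sum of the products of \<open>geo\<close> over l_1 < ... < l_p < l, with z marking
  \<open>r\<close>; the index v = 0 contributes nothing because \<open>geo 0 = 0\<close>.\<close>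

primrec nested_geo :: "nat \<Rightarrow> nat \<Rightarrow> real fps" where
  "nested_geo 0 l = 1"
| "nested_geo (Suc p) l = (\<Sum>v<l. geo v * nested_geo p v)"

lemma nonneg_nested_geo: "nonneg_fps (nested_geo p l)"
  by (induction p arbitrary: l) (auto intro!: nonneg_fps_1 nonneg_fps_sum nonneg_fps_mult nonneg_geo)

section \<open>Square-root growth of the nested sums\<close>

lemma inverse_sqrt_le: "1 / sqrt (real l) \<le> 4 * sqrt (real (Suc l)) - 4 * sqrt (real l)"
proof (cases "l = 0")
  case False
  obtain x y where x: "x = sqrt (real l)" and y: "y = sqrt (real (Suc l))" by blast
  have pos: "0 < x" "0 < y" "x \<le> y" and sq: "x * x = real l" "y * y = x * x + 1"
    using False by (simp_all add: x y)
  have "y * y \<le> (2 * x) * (2 * x)" using sq False by simp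
  then have "y\<^sup>2 \<le> (2 * x)\<^sup>2" by (simp only: power2_eq_square)
  then have "y \<le> 2 * x" using pos by (intro power2_le_imp_le[of y "2 * x"]) simp_all
  then have "(y + x) * (y - x) \<le> 4 * x * (y - x)"
    using pos by (intro mult_right_mono) auto
  moreover have "(y + x) * (y - x) = 1" using sq(2) by (simp add: algebra_simps)
  ultimately have "1 / x \<le> 4 * x * (y - x) / x"
    using pos by (intro divide_right_mono) auto
  also have "\<dots> = 4 * y - 4 * x" using pos by simp
  finally show ?thesis by (simp only: x y)
qed simp

lemma sum_inverse_sqrt_le: "(\<Sum>v<l. 1 / sqrt (real v)) \<le> 4 * sqrt (real l)"
proof (induction l)
  case (Suc l)
  with inverse_sqrt_le[of l] show ?case by (simp del: of_nat_Suc)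
qed simp

lemma geo_nested_geo_nth_le:
  assumes "\<And>r. 0 < l \<Longrightarrow> nested_geo p l $ r \<le> C r * sqrt (real l)"
  shows "(geo l * nested_geo p l) $ r \<le> (\<Sum>i=0..r. C (r - i)) / sqrt (real l)"
proof (cases "l = 0")
  case False
  have "(geo l * nested_geo p l) $ r = (\<Sum>i=0..r. geo l $ i * nested_geo p l $ (r - i))"
    by (simp add: fps_mult_nth)
  also have "\<dots> \<le> (\<Sum>i=0..r. inverse (real l) * (C (r - i) * sqrt (real l)))"
    using False by (intro sum_mono mult_mono assms geo_nth_le nonneg_fpsD nonneg_nested_geo) auto
  also have "\<dots> = (\<Sum>i=0..r. C (r - i)) * (sqrt (real l) / real l)"
    unfolding sum_distrib_right by (intro sum.cong) (simp_all add: field_simps)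
  also have "sqrt (real l) / real l = 1 / sqrt (real l)"
    using False real_div_sqrt[of "real l"] by (simp add: divide_simps)
  finally show ?thesis by simp
qed simp

text \<open>The bound by sqrt l survives each nesting: division by \<open>l\<close> gives l^(-1/2),
  whose partial sums are again at most 4 sqrt l.\<close>

lemma nested_geo_nth_le: "\<exists>C. \<forall>r l. 0 < l \<longrightarrow> nested_geo p l $ r \<le> C r * sqrt (real l)"
proof (induction p)
  case 0
  show ?case by (rule exI[of _ "\<lambda>_. 1"]) auto
next
  case (Suc p)
  then obtain C where C: "\<And>r l. 0 < l \<Longrightarrow> nested_geo p l $ r \<le> C r * sqrt (real l)" by blast
  define D where "D r = (\<Sum>i=0..r. C (r - i))" for r
  \<comment> \<open>Read off at l = 1, where the square root is 1.\<close>
  have "0 \<le> C r" for r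
    using C[of 1 r] nonneg_fpsD[OF nonneg_nested_geo, of p 1 r] by simp
  then have D: "0 \<le> D r" for r by (simp add: D_def sum_nonneg)
  have "nested_geo (Suc p) l $ r \<le> D r * 4 * sqrt (real l)" for r l
  proof -
    have "nested_geo (Suc p) l $ r = (\<Sum>v<l. (geo v * nested_geo p v) $ r)"
      by (simp add: fps_sum_nth)
    also have "\<dots> \<le> (\<Sum>v<l. D r / sqrt (real v))"
      unfolding D_def by (intro sum_mono geo_nested_geo_nth_le C)
    also have "\<dots> = D r * (\<Sum>v<l. 1 / sqrt (real v))"
      by (simp add: sum_distrib_left)
    also have "\<dots> \<le> D r * (4 * sqrt (real l))"
      by (intro mult_left_mono sum_inverse_sqrt_le D)
    finally show ?thesis by simp
  qed
  then show ?case by (intro exI[of _ "\<lambda>r. D r * 4"]) auto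
qed

text \<open>The operator T iterated on the kernel; for l > 0 the sums may stop below
  \<open>l\<close> because the kernel vanishes from there on.\<close>

primrec kern_iter :: "nat \<Rightarrow> nat \<Rightarrow> nat \<Rightarrow> real fps" where
  "kern_iter 0 l a = kern l a"
| "kern_iter (Suc s) l a = (\<Sum>v\<in>{a<..<l}. fps_const (inverse (real v)) * kern_iter s l v)"

lemma nonneg_kern_iter: "nonneg_fps (kern_iter s l a)"
  by (induction s arbitrary: a)
    (auto intro!: nonneg_kern nonneg_fps_sum nonneg_fps_mult nonneg_fps_const)

lemma kern_iter_eq_0: "0 < l \<Longrightarrow> l \<le> a \<Longrightarrow> kern_iter s l a = 0"
  by (cases s) (auto simp: kern_eq_0)

text \<open>Turns T, acting on the second argument, into a sum over the first. Induction on
  \<open>l\<close>: after multiplication by 1/(v + 1), \<open>kern_diff\<close> writes the increment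
  as \<open>geo l\<close> times a difference in \<open>v\<close>, which telescopes to
  \<open>kern l b\<close>.\<close>

lemma kern_iter_1: "kern_iter (Suc 0) l b = (\<Sum>u<l. geo u * kern u b)"
proof -
  \<comment> \<open>Admits v = l, whose term is zero, and shifts the index so that
    \<open>kern_diff\<close> applies at \<open>Suc v\<close>.\<close>
  have 1: "kern_iter (Suc 0) l b = (\<Sum>v=b..<l. fps_const (inverse (real (Suc v))) * kern l (Suc v))" if "0 < l" for l
  proof -
    have "kern_iter (Suc 0) l b = (\<Sum>v\<in>{b<..l}. fps_const (inverse (real v)) * kern l v)"
      unfolding kern_iter.simps using that by (intro sum.mono_neutral_left) (auto simp: kern_eq_0)
    also have "{b<..l} = Suc ` {b..<l}"
      by (simp add: atLeastLessThanSuc_atLeastAtMost atLeastSucAtMost_greaterThanAtMost)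
    finally show ?thesis by (simp add: sum.reindex del: sum.op_ivl_Suc of_nat_Suc image_Suc_atLeastLessThan kern_iter.simps)
  qed
  show ?thesis
  proof (induction l)
    case (Suc l)
    show ?case
    proof (cases "l = 0")
      case False
      have *: "fps_const (inverse (real (Suc v))) * kern (Suc l) (Suc v)
        = fps_const (inverse (real (Suc v))) * kern l (Suc v) + geo l * (kern l v - kern l (Suc v))" for v
      proof -
        have "fps_const (inverse (real (Suc v))) * (kern (Suc l) (Suc v) - kern l (Suc v))
          = (fps_const (inverse (real (Suc v))) * fps_const (real (Suc v))) * (geo l * (kern l v - kern l (Suc v)))"
          unfolding kern_diff by (simp only: mult_ac)
        also have "fps_const (inverse (real (Suc v))) * fps_const (real (Suc v)) = 1"
          by (simp del: of_nat_Suc)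
        finally show ?thesis by (simp add: algebra_simps)
      qed
      have "kern_iter (Suc 0) (Suc l) b = (\<Sum>v=b..<Suc l. fps_const (inverse (real (Suc v))) * kern l (Suc v))
         + geo l * (\<Sum>v=b..<Suc l. kern l v - kern l (Suc v))"
        by (simp only: 1[OF zero_less_Suc] * sum.distrib sum_distrib_left)
      also have "(\<Sum>v=b..<Suc l. fps_const (inverse (real (Suc v))) * kern l (Suc v)) = kern_iter (Suc 0) l b"
        using False by (subst 1) (auto intro!: sum.mono_neutral_right simp: kern_eq_0)
      also have "geo l * (\<Sum>v=b..<Suc l. kern l v - kern l (Suc v)) = geo l * kern l b"
      proof (cases "b \<le> l")
        case True
        then have "(\<Sum>v=b..<Suc l. kern l v - kern l (Suc v)) = kern l b"
          using sum_Suc_diff'[of b "Suc l" "\<lambda>v. - kern l v"] False by (simp add: kern_eq_0)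
        then show ?thesis by simp
      qed (simp add: geo_kern_eq_0)
      finally show ?thesis using Suc by simp
    qed simp
  qed simp
qed

text \<open>Lifts \<open>kern_iter_1\<close> to all iterates: T commutes with the finite sum over
  \<open>u\<close>, and the terms with v \<ge> u drop out.\<close>

lemma kern_iter_Suc: "kern_iter (Suc s) l b = (\<Sum>u<l. geo u * kern_iter s u b)"
proof (induction s arbitrary: l b)
  case 0
  then show ?case using kern_iter_1 by simp
next
  case (Suc s)
  have "kern_iter (Suc (Suc s)) l b = (\<Sum>v\<in>{b<..<l}. \<Sum>u<l. fps_const (inverse (real v)) * (geo u * kern_iter s u v))"
    by (subst kern_iter.simps(2)) (simp only: Suc sum_distrib_left)
  also have "\<dots> = (\<Sum>u<l. \<Sum>v\<in>{b<..<l}. geo u * (fps_const (inverse (real v)) * kern_iter s u v))"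
    by (subst sum.swap) (simp only: mult_ac)
  also have "\<dots> = (\<Sum>u<l. \<Sum>v\<in>{b<..<u}. geo u * (fps_const (inverse (real v)) * kern_iter s u v))"
  proof (rule sum.cong[OF refl])
    fix u assume u: "u \<in> {..<l}"
    show "(\<Sum>v\<in>{b<..<l}. geo u * (fps_const (inverse (real v)) * kern_iter s u v)) =
      (\<Sum>v\<in>{b<..<u}. geo u * (fps_const (inverse (real v)) * kern_iter s u v))"
      using u by (intro sum.mono_neutral_right) (cases "u = 0"; auto simp: kern_iter_eq_0)+
  qed
  finally show ?case by (simp add: sum_distrib_left)
qed

text \<open>At a = 0 the kernel is 1, so \<open>kern_iter_Suc\<close> becomes the recursion of
  \<open>nested_geo\<close>.\<close>

lemma kern_iter_nested_geo: "kern_iter s l 0 = nested_geo s l"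
proof (induction s arbitrary: l)
  case (Suc s)
  then show ?case by (simp only: kern_iter_Suc nested_geo.simps)
qed simp

subsection \<open>Tail sums over chains\<close>

text \<open>Nonnegativity upgrades the ordered telescoping series to an unconditional sum.\<close>

lemma has_sum_telescope:
  fixes f g :: "nat \<Rightarrow> real"
  assumes "f \<longlonglongrightarrow> 0" "\<And>v. a \<le> v \<Longrightarrow> g (Suc v) = f v - f (Suc v)" "\<And>v. a < v \<Longrightarrow> 0 \<le> g v"
  shows "(g has_sum f a) {a<..}"
proof -
  have "(\<lambda>i. f (i + a)) \<longlonglongrightarrow> 0" using assms(1) by (rule LIMSEQ_ignore_initial_segment)
  then have "(\<lambda>i. f (i + a) - f (Suc i + a)) sums (f (0 + a) - 0)" by (rule telescope_sums')
  also have "(\<lambda>i. f (i + a) - f (Suc i + a)) = (\<lambda>i. g (Suc (i + a)))"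
    using assms(2) by auto
  finally have "((\<lambda>i. g (Suc (i + a))) has_sum f a) UNIV"
    using assms(3) by (intro sums_nonneg_imp_has_sum) auto
  also have "?this \<longleftrightarrow> ?thesis"
    by (rule has_sum_reindex_bij_witness[where i = "\<lambda>v. v - Suc a" and j = "\<lambda>i. Suc (i + a)"]) auto
  finally show ?thesis .
qed

lemma infsum_abs_le:
  fixes f g :: "'a \<Rightarrow> real"
  assumes "(g has_sum S) A" "\<And>x. x \<in> A \<Longrightarrow> \<bar>f x\<bar> \<le> g x"
  shows "f summable_on A" "\<bar>infsum f A\<bar> \<le> S"
proof -
  have "(\<lambda>x. norm (f x)) summable_on A"
    using assms by (intro summable_on_comparison_test[of g A "\<lambda>x. norm (f x)"]) (auto simp: has_sum_iff)
  then show *: "f summable_on A" by (rule abs_summable_summable)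
  show "\<bar>infsum f A\<bar> \<le> S"
    using norm_infsum_le[OF has_sum_infsum[OF *] assms(1)] assms(2) by simp
qed

lemma has_sum_inverse_consecutive:
  "((\<lambda>v. C / (real v * real (Suc v))) has_sum C / real (Suc a)) {a<..}" if "0 \<le> C"
proof (rule has_sum_telescope)
  show "(\<lambda>a. C / real (Suc a)) \<longlonglongrightarrow> 0"
    by (rule LIMSEQ_Suc[OF lim_const_over_n])
qed (use that in \<open>auto simp: field_simps\<close>)

lemma tail_bound:
  assumes "\<And>v. a < v \<Longrightarrow> \<bar>g v\<bar> \<le> C / (real v * real (Suc v))"
  shows "g summable_on {a<..}" "\<bar>infsum g {a<..}\<bar> \<le> C / real (Suc a)"
proof -
  \<comment> \<open>The hypothesis at v = a + 1 forces C \<ge> 0.\<close>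
  have "0 \<le> C / (real (Suc a) * real (Suc (Suc a)))"
    using assms[of "Suc a"] abs_ge_zero order_trans by blast
  then have "0 \<le> C" by (subst (asm) pos_le_divide_eq) auto
  from has_sum_inverse_consecutive[OF this] assms
  show "g summable_on {a<..}" "\<bar>infsum g {a<..}\<bar> \<le> C / real (Suc a)"
    by (auto intro: infsum_abs_le)
qed

text \<open>Comparison with the telescoping majorant from \<open>sqrt_gap\<close>. The sum is over
  \<open>UNIV\<close> because the series over \<open>l\<close> are, with their first terms
  zero.\<close>

lemma sqrt_tail_bound:
  fixes t :: "nat \<Rightarrow> real"
  assumes "\<And>v. a < v \<Longrightarrow> \<bar>t v\<bar> \<le> C / (real v * sqrt (real v))" "\<And>v. v \<le> a \<Longrightarrow> t v = 0"
  shows "t summable_on UNIV" "\<bar>infsum t UNIV\<bar> \<le> 4 * C / sqrt (real (Suc a))"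
proof -
  have "0 \<le> C / (real (Suc a) * sqrt (real (Suc a)))"
    using assms(1)[of "Suc a"] abs_ge_zero order_trans by blast
  then have C: "0 \<le> C" by (subst (asm) pos_le_divide_eq) auto
  define f where "f v = 4 * C / sqrt (real (Suc v))" for v
  define g where "g v = C * (4 / sqrt (real v) - 4 / sqrt (real (Suc v)))" for v
  have g: "C / (real v * sqrt (real v)) \<le> g v" if "0 < v" for v
    using mult_left_mono[OF sqrt_gap[OF that] C] by (simp add: g_def)
  have "(g has_sum f a) {a<..}"
  proof (rule has_sum_telescope)
    show "f \<longlonglongrightarrow> 0" unfolding f_def
      by (rule real_tendsto_divide_at_top[OF tendsto_const filterlim_compose[OF sqrt_at_top
        filterlim_compose[OF filterlim_real_sequentially filterlim_Suc]]])
    show "g (Suc v) = f v - f (Suc v)" for v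
      by (simp add: f_def g_def algebra_simps)
    show "0 \<le> g v" if "a < v" for v
      using C by (intro order_trans[OF _ g]) (use that in auto)
  qed
  moreover have "\<bar>t v\<bar> \<le> g v" if "v \<in> {a<..}" for v
    using assms(1)[of v] g[of v] that by auto
  ultimately have "t summable_on {a<..}" "\<bar>infsum t {a<..}\<bar> \<le> f a"
    using infsum_abs_le[OF \<open>(g has_sum f a) {a<..}\<close>, of t] by blast+
  moreover have "t summable_on {a<..} \<longleftrightarrow> t summable_on UNIV"
    using assms(2) by (intro summable_on_cong_neutral) auto
  moreover have "infsum t {a<..} = infsum t UNIV"
    using assms(2) by (intro infsum_cong_neutral) auto
  ultimately show "t summable_on UNIV" "\<bar>infsum t UNIV\<bar> \<le> 4 * C / sqrt (real (Suc a))"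
    by (simp_all add: f_def)
qed

text \<open>Coefficient \<open>q\<close> of \<open>chain m r a\<close> is the part of (A) carried by the last \<open>r + 1\<close> indices
  \<open>a < n\<^sub>1 < \<dots> < n\<^sub>r\<^sub>+\<^sub>1\<close>, summed over all compositions.\<close>

fun chain :: "nat \<Rightarrow> nat \<Rightarrow> nat \<Rightarrow> real fps" where
  "chain m 0 a = Abs_fps (\<lambda>q. \<Sum>\<^sub>\<infinity>n\<in>{a<..}. (geo (n + m) * fps_const (inverse (real n))) $ q)"
| "chain m (Suc r) a = Abs_fps (\<lambda>q. \<Sum>\<^sub>\<infinity>n\<in>{a<..}. (geo (n + m) * chain m r n) $ q)"

lemma nonneg_chain: "nonneg_fps (chain m r a)"
proof (induction r arbitrary: a)
  case 0
  then show ?case 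
    by (auto simp: nonneg_fps_def geo_nth intro!: infsum_nonneg)
next
  case (Suc r)
  then have "nonneg_fps (geo (n + m) * chain m r n)" for n
    by (intro nonneg_fps_mult nonneg_geo)
  then show ?case 
    by (auto simp: nonneg_fps_def intro!: infsum_nonneg)
qed

lemma geo_mult_decay:
  assumes "\<And>q n. \<bar>f n $ q\<bar> \<le> C q / real (Suc n)"
  assumes "0 < n"
  shows "\<bar>(geo (n + m) * f n) $ q\<bar> \<le> (\<Sum>i=0..q. C (q - i)) / (real n * real (Suc n))"
proof -
  have "\<bar>(geo (n + m) * f n) $ q\<bar> \<le> (\<Sum>i=0..q. \<bar>geo (n + m) $ i * f n $ (q - i)\<bar>)"
    unfolding fps_mult_nth by (rule sum_abs)
  also have "\<dots> \<le> (\<Sum>i=0..q. inverse (real n) * (C (q - i) / real (Suc n)))"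
  proof (rule sum_mono)
    fix i
    have "\<bar>geo (n + m) $ i\<bar> \<le> inverse (real n)"
      using geo_nth_le[of n "n + m" i] assms(2) by (simp add: geo_nth)
    then show "\<bar>geo (n + m) $ i * f n $ (q - i)\<bar> \<le> inverse (real n) * (C (q - i) / real (Suc n))"
      unfolding abs_mult using assms(1) by (intro mult_mono) auto
  qed
  also have "\<dots> = (\<Sum>i=0..q. C (q - i)) / (real n * real (Suc n))"
    unfolding sum_divide_distrib by (intro sum.cong) (auto simp: divide_simps)
  finally show ?thesis .
qed

text \<open>Proved together, since decay O(1/(a + 1)) at one level makes the summands of the next
  level O(1/(n (n + 1))). Summability has to be recorded because an infinite sum without it defaults
  to 0. The \<open>case\<close> covers both equations of \<open>chain\<close>.\<close>

lemma chain_summable_and_decay: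
  "(\<forall>q a. (\<lambda>n. (geo (n + m) * (case r of 0 \<Rightarrow> fps_const (inverse (real n)) | Suc r' \<Rightarrow> chain m r' n)) $ q) summable_on {a<..})
   \<and> (\<exists>C. \<forall>q a. \<bar>chain m r a $ q\<bar> \<le> C q / real (Suc a))"
proof (induction r)
  case 0
  have *: "\<bar>(geo (n + m) * fps_const (inverse (real n))) $ q\<bar> \<le> 2 / (real n * real (Suc n))"
    if "0 < n" for n q
  proof -
    have "\<bar>(geo (n + m) * fps_const (inverse (real n))) $ q\<bar> = geo (n + m) $ q * inverse (real n)"
      by (simp add: geo_nth)
    also have "\<dots> \<le> inverse (real n) * inverse (real n)"
      using that by (intro mult_right_mono geo_nth_le) auto
    also have "\<dots> = 2 / (real n * (2 * real n))" by (simp add: divide_simps)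
    also have "\<dots> \<le> 2 / (real n * real (Suc n))"
      using that by (intro divide_left_mono mult_left_mono mult_pos_pos) auto
    finally show ?thesis .
  qed
  have "(\<lambda>n. (geo (n + m) * fps_const (inverse (real n))) $ q) summable_on {a<..}"
       "\<bar>chain m 0 a $ q\<bar> \<le> 2 / real (Suc a)" for q a
    unfolding chain.simps fps_nth_Abs_fps by (rule tail_bound[where C = 2], rule *, simp)+
  then show ?case unfolding nat.case by (intro conjI exI[of _ "\<lambda>_. 2"] allI)
next
  case (Suc r)
  then obtain C where C: "\<And>q a. \<bar>chain m r a $ q\<bar> \<le> C q / real (Suc a)" by blast
  have "(\<lambda>n. (geo (n + m) * chain m r n) $ q) summable_on {a<..}"
       "\<bar>chain m (Suc r) a $ q\<bar> \<le> (\<Sum>i=0..q. C (q - i)) / real (Suc a)" for q a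
    unfolding chain.simps fps_nth_Abs_fps
    by (rule tail_bound[where C = "\<Sum>i=0..q. C (q - i)"], rule geo_mult_decay[OF C], simp)+
  then show ?case unfolding nat.case by (intro conjI exI[of _ "\<lambda>q. \<Sum>i=0..q. C (q - i)"] allI)
qed

lemma has_sum_chain_0:
  "((\<lambda>n. (geo (n + m) * fps_const (inverse (real n))) $ q) has_sum chain m 0 a $ q) {a<..}"
  using chain_summable_and_decay[of m 0] by (simp add: has_sum_infsum)

lemma has_sum_chain_Suc:
  "((\<lambda>n. (geo (n + m) * chain m r n) $ q) has_sum chain m (Suc r) a $ q) {a<..}"
  using chain_summable_and_decay[of m "Suc r"] by (simp add: has_sum_infsum)

text \<open>A rate that \<open>tail\<close> preserves, as the sum of 1/(v (v + 1)) over v > a is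
  1/(a + 1).\<close>

definition decays :: "(nat \<Rightarrow> real) \<Rightarrow> bool" where
  "decays f \<longleftrightarrow> (\<exists>C. \<forall>a. \<bar>f a\<bar> \<le> C / real (Suc a))"

lemma decays_chain: "decays (\<lambda>a. chain m r a $ q)"
proof -
  obtain C where "\<And>q a. \<bar>chain m r a $ q\<bar> \<le> C q / real (Suc a)"
    using chain_summable_and_decay[of m r] by blast
  then show ?thesis unfolding decays_def by (intro exI[of _ "C q"]) auto
qed

text \<open>Multiplication of the recurrence by \<open>geo (Suc a + m)\<close> isolates the
  difference of consecutive values; summing these from \<open>a\<close> to infinity, with limit
  zero, reproduces the definition of \<open>chain\<close>.\<close>

lemma chain_unique:
  assumes nonneg: "\<And>r a. nonneg_fps (f r a)"
    and lim: "\<And>r q. (\<lambda>a. f r a $ q) \<longlonglongrightarrow> 0"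
    and 0: "\<And>a. (fps_const (real (Suc a + m)) - fps_X) * (f 0 a - f 0 (Suc a)) = fps_const (inverse (real (Suc a)))"
    and Suc: "\<And>r a. (fps_const (real (Suc a + m)) - fps_X) * (f (Suc r) a - f (Suc r) (Suc a)) = f r (Suc a)"
  shows "f r a = chain m r a"
proof -
  \<comment> \<open>Here \<open>h\<close> stands for the right-hand side of the recurrence, so that
    r = 0 and r > 0 are treated at once.\<close>
  have *: "f r a $ q = infsum (\<lambda>n. (geo (n + m) * h n) $ q) {a<..}"
    if h: "\<And>a. (fps_const (real (Suc a + m)) - fps_X) * (f r a - f r (Suc a)) = h (Suc a)"
      "\<And>a. nonneg_fps (h a)" for r a q h
  proof -
    have "geo (Suc a + m) * h (Suc a) = f r a - f r (Suc a)" for a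
      unfolding h(1)[symmetric] using geo_mult_left[of "Suc a + m"]
      by (simp add: mult.assoc[symmetric] mult.commute[of "geo (Suc (a + m))"] del: of_nat_Suc)
    then have "((\<lambda>n. (geo (n + m) * h n) $ q) has_sum f r a $ q) {a<..}"
      by (intro has_sum_telescope lim nonneg_fpsD nonneg_fps_mult nonneg_geo h(2)) (metis fps_sub_nth)
    then show ?thesis by (simp add: has_sum_iff)
  qed
  show ?thesis
  proof (induction r arbitrary: a)
    case 0
    have "f 0 a $ q = chain m 0 a $ q" for q
      unfolding chain.simps fps_nth_Abs_fps
      by (rule *[where h = "\<lambda>n. fps_const (inverse (real n))", OF assms(3)]) (simp add: nonneg_fps_const)
    then show ?case by (rule fps_ext)
  next
    case (Suc r)
    have "f (Suc r) a $ q = chain m (Suc r) a $ q" for q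
      unfolding chain.simps fps_nth_Abs_fps Suc[symmetric]
      by (rule *[where h = "f r", OF assms(4)]) (rule nonneg)
    then show ?case by (rule fps_ext)
  qed
qed

subsection \<open>Two series expansions of the chain sums\<close>

lemma tendsto_0_squeeze_abs:
  fixes f g :: "nat \<Rightarrow> real"
  assumes "g \<longlonglongrightarrow> 0" "\<And>a. \<bar>f a\<bar> \<le> g a"
  shows "f \<longlonglongrightarrow> 0"
  using assms by (intro Lim_null_comparison[of f g]) auto

section \<open>First expansion, with the rational kernel\<close>

lemma kern_tendsto: "(\<lambda>l. kern l a $ r) \<longlonglongrightarrow> (if r = 0 then 1 else 0)"
proof (induction a arbitrary: r)
  case 0
  show ?case by (simp add: fps_one_nth)
next
  case (Suc a)
  have geo_lim: "(\<lambda>l. (fps_const (real l - real (Suc a)) * geo (l - Suc a)) $ i) \<longlonglongrightarrow> (if i = 0 then 1 else 0)" for i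
  proof (rule LIMSEQ_offset[where k = "Suc a"])
    have *: "(\<lambda>n. inverse (real n) ^ i) \<longlonglongrightarrow> (if i = 0 then 1 else 0)"
      using tendsto_power[OF lim_inverse_n, of i] by (cases i) auto
    show "(\<lambda>n. (fps_const (real (n + Suc a) - real (Suc a)) * geo (n + Suc a - Suc a)) $ i)
        \<longlonglongrightarrow> (if i = 0 then 1 else 0)"
      by (rule Lim_transform_eventually[OF *])
         (use eventually_gt_at_top[of 0] in eventually_elim, simp add: geo_nth)
  qed
  have "(\<lambda>l. kern l (Suc a) $ r) \<longlonglongrightarrow> (\<Sum>i=0..r. (if i = 0 then 1 else 0) * (if r - i = 0 then 1 else 0))"
    unfolding kern_Suc fps_mult_nth[of "kern _ a"] by (intro tendsto_sum tendsto_mult Suc.IH geo_lim)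
  also have "(\<Sum>i=0..r. (if i = 0 then 1 else 0) * (if r - i = 0 then 1 else 0)) = (if r = 0 then 1 else (0::real))"
    by (simp add: sum.atLeast_Suc_atMost)
  finally show ?case .
qed

text \<open>Writes a + m - X as (l + m - X) - (l - a); the remaining factor l - a is one that
  \<open>geo_kern_step\<close> can absorb.\<close>

lemma geo_shift:
  assumes "0 < l + m"
  shows "(fps_const (real (a + m)) - fps_X) * geo (l + m) = 1 - fps_const (real l - real a) * geo (l + m)"
proof -
  have "(fps_const (real (a + m)) - fps_X) * geo (l + m)
      = (fps_const (real (l + m)) - fps_X) * geo (l + m) - fps_const (real l - real a) * geo (l + m)"
    by (simp add: algebra_simps flip: fps_const_add fps_const_sub)
  then show ?thesis using geo_mult_left[OF assms] by simp
qed

text \<open>The coefficient of z^r in the sum over \<open>l\<close> of \<open>kern l a\<close> / ((l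
  + m - X)(l - z)). Of the two variables only X stays a power series variable; z survives through
  the index \<open>r\<close>.\<close>

definition kern_series :: "nat \<Rightarrow> nat \<Rightarrow> nat \<Rightarrow> real fps" where
  "kern_series m r a = Abs_fps (\<lambda>q. \<Sum>\<^sub>\<infinity>l. geo (l + m) $ q * (geo l * kern l a) $ r)"

lemma kern_series_summable_and_bound:
  "(\<lambda>l. geo (l + m) $ q * (geo l * kern l a) $ r) summable_on UNIV" (is ?A)
  "\<bar>kern_series m r a $ q\<bar> \<le> 4 * ((real r + 1) * 4 ^ r) / sqrt (real (Suc a))" (is ?B)
proof -
  have bd: "\<bar>geo (v + m) $ q * (geo v * kern v a) $ r\<bar> \<le> ((real r + 1) * 4 ^ r) / (real v * sqrt (real v))"
    if "a < v" for v
  proof -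
    have "\<bar>geo (v + m) $ q * (geo v * kern v a) $ r\<bar> = geo (v + m) $ q * (geo v * kern v a) $ r"
      by (intro abs_of_nonneg mult_nonneg_nonneg nonneg_fpsD nonneg_fps_mult nonneg_geo nonneg_kern)
    also have "\<dots> \<le> inverse (real v) * ((real r + 1) * 4 ^ r / sqrt (real v))"
      by (intro mult_mono geo_nth_le geo_kern_nth_le nonneg_fpsD nonneg_fps_mult nonneg_geo nonneg_kern)
        (use that in auto)
    finally show ?thesis by (simp add: divide_simps)
  qed
  have 0: "geo (v + m) $ q * (geo v * kern v a) $ r = 0" if "v \<le> a" for v
    unfolding geo_kern_eq_0[OF that] by simp
  show ?A ?B unfolding kern_series_def fps_nth_Abs_fps
    using sqrt_tail_bound[OF bd 0] by blast+
qed

lemma has_sum_kern_series: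
  "((\<lambda>l. geo (l + m) $ q * (geo l * kern l a) $ r) has_sum kern_series m r a $ q) UNIV"
  using kern_series_summable_and_bound(1) by (simp add: kern_series_def has_sum_infsum)

text \<open>By \<open>kern_diff\<close> the summand is 1/(a + 1) times a forward difference in
  \<open>l\<close>, which telescopes from \<open>kern 0 (Suc a) = 0\<close> to the limit 1 of the
  kernel.\<close>

lemma kern_diff_sums:
  "(\<lambda>l. (geo l * kern l a - geo l * kern l (Suc a)) $ r) sums (if r = 0 then inverse (real (Suc a)) else 0)"
proof -
  have "(\<lambda>l. kern (Suc l) (Suc a) $ r - kern l (Suc a) $ r) sums ((if r = 0 then 1 else 0) - kern 0 (Suc a) $ r)"
    by (rule telescope_sums[OF kern_tendsto])
  moreover have "kern 0 (Suc a) = 0" by (simp add: kern_Suc)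
  moreover have "kern (Suc l) (Suc a) $ r - kern l (Suc a) $ r
     = real (Suc a) * (geo l * kern l a - geo l * kern l (Suc a)) $ r" for l
    using arg_cong[OF kern_diff[of l a], of "\<lambda>f. f $ r"]
    by (simp add: mult.assoc right_diff_distrib del: of_nat_Suc)
  ultimately have *: "(\<lambda>l. real (Suc a) * (geo l * kern l a - geo l * kern l (Suc a)) $ r) sums (if r = 0 then 1 else 0)"
    by simp
  have "inverse (real (Suc a)) * (real (Suc a) * x) = x" for x by simp
  with sums_mult[OF *, of "inverse (real (Suc a))"]
  have "(\<lambda>l. (geo l * kern l a - geo l * kern l (Suc a)) $ r) sums (inverse (real (Suc a)) * (if r = 0 then 1 else 0))"
    by (simp only:)
  then show ?thesis by (cases "r = 0") simp_all
qed

text \<open>By \<open>geo_shift\<close> the product splits in two. The constant 1 leaves the sum of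
  \<open>kern_diff_sums\<close>, present only for q = 0. In the other part l - a - 1 is absorbed by
  \<open>geo_kern_step\<close>, and the resulting factor z replaces \<open>r\<close> by r -
  1.\<close>

lemma kern_series_step:
  "((fps_const (real (Suc a + m)) - fps_X) * (kern_series m r a - kern_series m r (Suc a))) $ q =
   (if q = 0 \<and> r = 0 then inverse (real (Suc a)) else 0) + (if r = 0 then 0 else kern_series m (r - 1) (Suc a) $ q)"
proof -
  define d where "d l = (geo l * kern l a - geo l * kern l (Suc a)) $ r" for l
  define S where "S = kern_series m r a - kern_series m r (Suc a)"
  have S: "(\<lambda>l. geo (l + m) $ i * d l) sums (S $ i)" for i
  proof -
    have "(\<lambda>l. geo (l + m) $ i * (geo l * kern l a) $ r) sums (kern_series m r a $ i)" for a
      by (rule has_sum_imp_sums[OF has_sum_kern_series])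
    from sums_diff[OF this this] show ?thesis
      by (simp add: S_def d_def right_diff_distrib)
  qed
  have mult: "((fps_const c - fps_X) * f) $ q = c * f $ q - (if q = 0 then 0 else f $ (q - 1))"
    for c and f :: "real fps"
    by (simp add: left_diff_distrib)
  have 1: "(\<lambda>l. ((fps_const (real (Suc a + m)) - fps_X) * geo (l + m)) $ q * d l)
    sums (((fps_const (real (Suc a + m)) - fps_X) * S) $ q)"
  proof (cases "q = 0")
    case True
    then show ?thesis using sums_mult[OF S[of q], of "real (Suc a + m)"]
      unfolding mult by (simp add: mult.assoc)
  next
    case False
    then show ?thesis using sums_diff[OF sums_mult[OF S[of q], of "real (Suc a + m)"] S[of "q - 1"]]
      unfolding mult by (simp add: left_diff_distrib mult.assoc)
  qed
  \<comment> \<open>The first \<open>fps_X\<close> marks \<open>q\<close>; the one in the last term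
    is z and marks \<open>r\<close>.\<close>
  have 2: "((fps_const (real (Suc a + m)) - fps_X) * geo (l + m)) $ q * d l
     = (if q = 0 then d l else 0) + geo (l + m) $ q * (fps_X * (geo l * kern l (Suc a))) $ r" for l
  proof (cases "l = 0")
    case False
    have e: "(fps_X * (geo l * kern l (Suc a))) $ r = - ((real l - real (Suc a)) * d l)"
      unfolding geo_kern_step[symmetric] d_def fps_mult_left_const_nth fps_sub_nth
      by (simp only: minus_mult_right minus_diff_eq)
    have "((fps_const (real (Suc a + m)) - fps_X) * geo (l + m)) $ q
        = (if q = 0 then 1 else 0) - (real l - real (Suc a)) * geo (l + m) $ q"
      using False by (subst geo_shift) (auto simp: fps_one_nth)
    then show ?thesis
      unfolding e by (cases "q = 0") (simp_all only: left_diff_distrib, simp_all add: algebra_simps)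
  qed (simp add: d_def)
  have 3: "(\<lambda>l. if q = 0 then d l else 0) sums (if q = 0 \<and> r = 0 then inverse (real (Suc a)) else 0)"
    using kern_diff_sums[of a r, folded d_def] by (cases "q = 0"; cases "r = 0") simp_all
  have 4: "(\<lambda>l. geo (l + m) $ q * (fps_X * (geo l * kern l (Suc a))) $ r)
    sums (if r = 0 then 0 else kern_series m (r - 1) (Suc a) $ q)"
    using has_sum_imp_sums[OF has_sum_kern_series] by (cases r) simp_all
  from sums_unique2[OF 1] sums_add[OF 3 4] show ?thesis
    unfolding 2 S_def by blast
qed

lemma chain_eq_kern_series: "kern_series m r a = chain m r a"
proof (rule chain_unique)
  show "nonneg_fps (kern_series m r a)" for r a
    unfolding nonneg_fps_def kern_series_def fps_nth_Abs_fps
    by (intro allI infsum_nonneg mult_nonneg_nonneg nonneg_fpsD nonneg_fps_mult nonneg_geo nonneg_kern)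
  show "(\<lambda>a. kern_series m r a $ q) \<longlonglongrightarrow> 0" for r q
    by (rule tendsto_0_squeeze_abs[OF _ kern_series_summable_and_bound(2)])
      (rule real_tendsto_divide_at_top[OF tendsto_const filterlim_compose[OF sqrt_at_top
        filterlim_compose[OF filterlim_real_sequentially filterlim_Suc]]])
  show "(fps_const (real (Suc a + m)) - fps_X) * (kern_series m 0 a - kern_series m 0 (Suc a))
      = fps_const (inverse (real (Suc a)))" for a
    by (rule fps_ext, subst kern_series_step) simp
  show "(fps_const (real (Suc a + m)) - fps_X) * (kern_series m (Suc r) a - kern_series m (Suc r) (Suc a))
      = kern_series m r (Suc a)" for r a
    by (rule fps_ext, subst kern_series_step) simp
qed

lemma chain_has_sum_kern:
  "((\<lambda>l. geo (l + m) $ q * (geo l * kern l a) $ r) has_sum chain m r a $ q) UNIV"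
  using has_sum_kern_series chain_eq_kern_series by simp

section \<open>Second expansion, with the Beta kernel\<close>

text \<open>For \<open>n > 0\<close> this is the Beta value \<open>B(a + 1, n)\<close>.\<close>

definition beta_nat :: "nat \<Rightarrow> nat \<Rightarrow> real" where
  "beta_nat a n = fact a * fact (n - 1) / fact (a + n)"

lemma beta_nat_nonneg: "0 \<le> beta_nat a n"
  by (simp add: beta_nat_def)

lemma beta_nat_0: "0 < n \<Longrightarrow> beta_nat 0 n = inverse (real n)"
  by (cases n) (simp_all add: beta_nat_def field_simps del: of_nat_Suc)

lemma beta_nat_Suc_0: "beta_nat a (Suc 0) = inverse (real (Suc a))"
  unfolding beta_nat_def add_Suc_right fact_Suc by (simp add: divide_simps del: of_nat_Suc)

lemma beta_nat_Suc_left: "0 < n \<Longrightarrow> beta_nat (Suc a) n = beta_nat a n * (real (Suc a) / real (Suc (a + n)))"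
  unfolding beta_nat_def add_Suc fact_Suc[of a] fact_Suc[of "a + n"] by (simp add: mult_ac del: of_nat_Suc)

lemma beta_nat_Suc_right: "0 < n \<Longrightarrow> beta_nat a (Suc n) = beta_nat a n * (real n / real (Suc (a + n)))"
  unfolding beta_nat_def add_Suc_right fact_Suc[of "a + n"] by (cases n) (simp_all add: mult_ac del: of_nat_Suc)

text \<open>In the integral of t^a (1 - t)^(n - 1), the difference contributes a further factor 1 -
  t.\<close>

lemma beta_nat_diff:
  assumes "0 < n"
  shows "beta_nat a n - beta_nat (Suc a) n = beta_nat a (Suc n)"
proof -
  have "1 - real (Suc a) / real (Suc (a + n)) = real n / real (Suc (a + n))"
    by (simp add: divide_simps)
  then show ?thesis
    unfolding beta_nat_Suc_left[OF assms] beta_nat_Suc_right[OF assms] by (metis mult.right_neutral right_diff_distrib)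
qed

text \<open>Integration by parts in the Beta integral.\<close>

lemma beta_nat_Suc: "0 < n \<Longrightarrow> real n * beta_nat (Suc a) n = real (Suc a) * beta_nat a (Suc n)"
  by (simp only: beta_nat_Suc_left beta_nat_Suc_right) simp

text \<open>Amounts to (a + 1)! n! \<le> (a + n)!. It supplies decay in both arguments: in
  \<open>n\<close> for summability over \<open>l\<close>, in \<open>a\<close> for the limit zero at
  infinity.\<close>

lemma beta_nat_le: "0 < n \<Longrightarrow> beta_nat a n \<le> 1 / (real n * real (Suc a))"
proof -
  assume n: "0 < n"
  have "(fact (Suc a) :: real) * fact (Suc k) \<le> fact (a + Suc k)" for k
  proof (induction k)
    case (Suc k)
    have "(fact (Suc a) :: real) * fact (Suc (Suc k)) = real (Suc (Suc k)) * (fact (Suc a) * fact (Suc k))"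
      by (simp add: algebra_simps)
    also have "\<dots> \<le> real (Suc (a + Suc k)) * fact (a + Suc k)"
      by (intro mult_mono Suc) auto
    finally show ?case by simp
  qed simp
  from this[of "n - 1"] n have *: "(fact (Suc a) :: real) * fact n \<le> fact (a + n)" by simp
  have "beta_nat a n = (fact (Suc a) * fact n) / fact (a + n) / (real n * real (Suc a))"
    using n by (cases n) (simp_all add: beta_nat_def divide_simps del: of_nat_Suc)
  also have "\<dots> \<le> 1 / (real n * real (Suc a))"
    using * by (intro divide_right_mono) auto
  finally show ?thesis .
qed

text \<open>Here the power series variable marks \<open>p\<close>, and \<open>r\<close> is again the
  index for z. The junk value \<open>beta_nat a 0 = 1\<close> is cancelled by
  \<open>geo 0 = 0\<close>.\<close>

definition nested_geo_series :: "nat \<Rightarrow> nat \<Rightarrow> real fps" where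
  "nested_geo_series r a = Abs_fps (\<lambda>p. \<Sum>\<^sub>\<infinity>l. (geo l * nested_geo p l) $ r * beta_nat a l)"

lemma nested_geo_series_summable_and_decay:
  "(\<forall>a. (\<lambda>l. (geo l * nested_geo p l) $ r * beta_nat a l) summable_on UNIV) \<and>
   (\<exists>C. \<forall>a. \<bar>nested_geo_series r a $ p\<bar> \<le> C / real (Suc a))"
proof -
  obtain C where C: "\<And>r l. 0 < l \<Longrightarrow> nested_geo p l $ r \<le> C r * sqrt (real l)"
    using nested_geo_nth_le by blast
  define D where "D = (\<Sum>i=0..r. C (r - i))"
  have bd: "\<bar>(geo v * nested_geo p v) $ r * beta_nat a v\<bar> \<le> (D / real (Suc a)) / (real v * sqrt (real v))"
    if "0 < v" for v a
  proof -
    have "\<bar>(geo v * nested_geo p v) $ r * beta_nat a v\<bar> = (geo v * nested_geo p v) $ r * beta_nat a v"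
      by (intro abs_of_nonneg mult_nonneg_nonneg nonneg_fpsD nonneg_fps_mult nonneg_geo nonneg_nested_geo beta_nat_nonneg)
    also have "\<dots> \<le> (D / sqrt (real v)) * (1 / (real v * real (Suc a)))"
    proof (rule mult_mono)
      show "(geo v * nested_geo p v) $ r \<le> D / sqrt (real v)"
        unfolding D_def by (rule geo_nested_geo_nth_le[OF C])
      with nonneg_fpsD[OF nonneg_fps_mult[OF nonneg_geo nonneg_nested_geo], of v p v r]
      show "0 \<le> D / sqrt (real v)" by linarith
    qed (use that in \<open>auto intro: beta_nat_le beta_nat_nonneg simp del: of_nat_Suc\<close>)
    finally show ?thesis by (simp add: mult_ac)
  qed
  have "(\<lambda>l. (geo l * nested_geo p l) $ r * beta_nat a l) summable_on UNIV"
    "\<bar>nested_geo_series r a $ p\<bar> \<le> (4 * D) / real (Suc a)" for a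
    using sqrt_tail_bound[of 0, OF bd[of _ a]] by (auto simp: nested_geo_series_def)
  then show ?thesis by blast
qed

lemma has_sum_nested_geo_series:
  "((\<lambda>l. (geo l * nested_geo p l) $ r * beta_nat a l) has_sum nested_geo_series r a $ p) UNIV"
  using nested_geo_series_summable_and_decay by (simp add: nested_geo_series_def has_sum_infsum)

lemma nested_geo_beta_nat_tendsto: "(\<lambda>l. nested_geo p l $ r * beta_nat a l) \<longlonglongrightarrow> 0"
proof -
  obtain C where C: "\<And>r l. 0 < l \<Longrightarrow> nested_geo p l $ r \<le> C r * sqrt (real l)"
    using nested_geo_nth_le by blast
  have "(\<lambda>l. nested_geo p (Suc l) $ r * beta_nat a (Suc l)) \<longlonglongrightarrow> 0"
  proof (rule tendsto_0_squeeze_abs)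
    show "(\<lambda>l. C r / sqrt (real (Suc l))) \<longlonglongrightarrow> 0"
      by (rule real_tendsto_divide_at_top[OF tendsto_const filterlim_compose[OF sqrt_at_top
        filterlim_compose[OF filterlim_real_sequentially filterlim_Suc]]])
    fix l
    have "beta_nat a (Suc l) \<le> 1 / (real (Suc l) * real (Suc a))" by (rule beta_nat_le) simp
    also have "\<dots> \<le> 1 / (real (Suc l) * 1)"
      by (intro divide_left_mono mult_left_mono) auto
    finally have beta_nat: "beta_nat a (Suc l) \<le> 1 / real (Suc l)" by simp
    have "\<bar>nested_geo p (Suc l) $ r * beta_nat a (Suc l)\<bar> = nested_geo p (Suc l) $ r * beta_nat a (Suc l)"
      by (intro abs_of_nonneg mult_nonneg_nonneg nonneg_fpsD nonneg_nested_geo beta_nat_nonneg)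
    also have "\<dots> \<le> (C r * sqrt (real (Suc l))) * (1 / real (Suc l))"
      using C[of "Suc l" r] nonneg_fpsD[OF nonneg_nested_geo, of p "Suc l" r]
      by (intro mult_mono beta_nat beta_nat_nonneg) auto
    also have "\<dots> = C r * (sqrt (real (Suc l)) / real (Suc l))" by simp
    also have "sqrt (real (Suc l)) / real (Suc l) = 1 / sqrt (real (Suc l))"
      using real_div_sqrt[of "real (Suc l)"] by (simp add: divide_simps del: of_nat_Suc)
    finally show "\<bar>nested_geo p (Suc l) $ r * beta_nat a (Suc l)\<bar> \<le> C r / sqrt (real (Suc l))" by simp
  qed
  then show ?thesis by (rule LIMSEQ_imp_Suc)
qed

text \<open>Summation by parts. The difference in \<open>a\<close> turns B(a+1, l) into B(a+1, l+1);
  times a + 1 this is l B(a+2, l), and l/(l - z) = 1 + z/(l - z) separates the part with r - 1. The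
  subtracted X-part is the increment of \<open>nested_geo p\<close>, so that the rest is a
  difference of consecutive values of \<open>G\<close>.\<close>

lemma nested_geo_series_step:
  "((fps_const (real (Suc a)) - fps_X) * (nested_geo_series r a - nested_geo_series r (Suc a))) $ p =
   (if p = 0 \<and> r = 0 then inverse (real (Suc a)) else 0) + (if r = 0 then 0 else nested_geo_series (r - 1) (Suc a) $ p)"
proof -
  define c where "c p l = (geo l * nested_geo p l) $ r" for p l
  define S where "S = nested_geo_series r a - nested_geo_series r (Suc a)"
  define c' where "c' l = (if p = 0 then 0 else c (p - 1) l)" for l
  \<comment> \<open>The sums start at l = 1: the term at 0 is zero, and the Beta relations require a
    positive argument.\<close>
  have Suc_sums: "(\<lambda>l. f (Suc l)) sums s" if "(f has_sum s) UNIV" "f 0 = 0" for f :: "nat \<Rightarrow> real" and s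
    using has_sum_imp_sums[OF that(1)] that(2) sums_Suc_iff[of f s] by simp
  have series: "(\<lambda>l. (geo (Suc l) * nested_geo p (Suc l)) $ r * beta_nat a (Suc l)) sums (nested_geo_series r a $ p)" for p r a
    by (rule Suc_sums[OF has_sum_nested_geo_series]) simp
  have S: "(\<lambda>l. c p (Suc l) * beta_nat a (Suc (Suc l))) sums (S $ p)" for p
    using sums_diff[OF series[of p r a] series[of p r "Suc a"]] beta_nat_diff[of "Suc l" a for l]
    by (simp add: S_def c_def right_diff_distrib[symmetric])
  have mult: "((fps_const x - fps_X) * f) $ p = x * f $ p - (if p = 0 then 0 else f $ (p - 1))"
    for x and f :: "real fps"
    by (simp add: left_diff_distrib)
  have 1: "(\<lambda>l. (real (Suc a) * c p (Suc l) - c' (Suc l)) * beta_nat a (Suc (Suc l)))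
    sums (((fps_const (real (Suc a)) - fps_X) * S) $ p)"
  proof (cases "p = 0")
    case True
    then show ?thesis using sums_mult[OF S[of p], of "real (Suc a)"]
      unfolding mult by (simp add: mult.assoc c'_def)
  next
    case False
    then show ?thesis using sums_diff[OF sums_mult[OF S[of p], of "real (Suc a)"] S[of "p - 1"]]
      unfolding mult by (simp add: left_diff_distrib mult.assoc c'_def)
  qed
  define G where "G l = nested_geo p l $ r * beta_nat a l" for l
  have nested_geo_Suc: "nested_geo p (Suc l) $ r = nested_geo p l $ r + c' l" for l
    by (cases p) (simp_all add: c'_def c_def)
  have 2: "(real (Suc a) * c p l - c' l) * beta_nat a (Suc l)
     = (G l - G (Suc l)) + (fps_X * (geo l * nested_geo p l)) $ r * beta_nat (Suc a) l" if "0 < l" for l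
  proof -
    have "real l * c p l = ((fps_const (real l) * geo l) * nested_geo p l) $ r"
      by (simp add: c_def mult.assoc)
    also have "\<dots> = nested_geo p l $ r + (fps_X * (geo l * nested_geo p l)) $ r"
      unfolding geo_const[OF that] distrib_right mult_1 mult.assoc by simp
    finally have l: "real l * c p l = nested_geo p l $ r + (fps_X * (geo l * nested_geo p l)) $ r" .
    have "real (Suc a) * c p l * beta_nat a (Suc l) = (real l * c p l) * beta_nat (Suc a) l"
      using beta_nat_Suc[OF that, of a] by (metis mult.assoc mult.commute)
    then have "(real (Suc a) * c p l - c' l) * beta_nat a (Suc l) =
        (nested_geo p l $ r + (fps_X * (geo l * nested_geo p l)) $ r) * beta_nat (Suc a) l - c' l * beta_nat a (Suc l)"
      unfolding l left_diff_distrib by simp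
    then show ?thesis
      unfolding G_def nested_geo_Suc beta_nat_diff[OF that, symmetric] by (simp add: algebra_simps)
  qed
  have "(\<lambda>l. G (Suc l) - G (Suc (Suc l))) sums (G (Suc 0) - 0)"
    by (rule telescope_sums'[OF LIMSEQ_Suc]) (simp only: G_def nested_geo_beta_nat_tendsto)
  \<comment> \<open>For p > 0, \<open>nested_geo p 1\<close> consists of a single multiple of
    \<open>geo 0\<close>, hence vanishes.\<close>
  moreover have "G (Suc 0) = (if p = 0 \<and> r = 0 then inverse (real (Suc a)) else 0)"
    by (cases p) (auto simp: G_def beta_nat_Suc_0 fps_one_nth)
  ultimately have 3: "(\<lambda>l. G (Suc l) - G (Suc (Suc l))) sums (if p = 0 \<and> r = 0 then inverse (real (Suc a)) else 0)"
    by simp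
  have 4: "(\<lambda>l. (fps_X * (geo (Suc l) * nested_geo p (Suc l))) $ r * beta_nat (Suc a) (Suc l))
    sums (if r = 0 then 0 else nested_geo_series (r - 1) (Suc a) $ p)"
    using series[of p "r - 1" "Suc a"] by (cases r) simp_all
  from sums_unique2[OF 1] sums_add[OF 3 4] show ?thesis
    unfolding 2[OF zero_less_Suc] S_def by blast
qed

lemma chain_eq_nested_geo_series: "nested_geo_series r a = chain 0 r a"
proof (rule chain_unique)
  show "nonneg_fps (nested_geo_series r a)" for r a
    unfolding nonneg_fps_def nested_geo_series_def fps_nth_Abs_fps
    by (intro allI infsum_nonneg mult_nonneg_nonneg nonneg_fpsD nonneg_fps_mult nonneg_geo nonneg_nested_geo beta_nat_nonneg)
  show "(\<lambda>a. nested_geo_series r a $ p) \<longlonglongrightarrow> 0" for r p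
  proof -
    obtain C where "\<And>a. \<bar>nested_geo_series r a $ p\<bar> \<le> C / real (Suc a)"
      using nested_geo_series_summable_and_decay by blast
    then show ?thesis by (rule tendsto_0_squeeze_abs[OF LIMSEQ_Suc[OF lim_const_over_n]])
  qed
  show "(fps_const (real (Suc a + 0)) - fps_X) * (nested_geo_series 0 a - nested_geo_series 0 (Suc a))
      = fps_const (inverse (real (Suc a)))" for a
    unfolding add_0_right by (rule fps_ext, subst nested_geo_series_step) simp
  show "(fps_const (real (Suc a + 0)) - fps_X) * (nested_geo_series (Suc r) a - nested_geo_series (Suc r) (Suc a))
      = nested_geo_series r (Suc a)" for r a
    unfolding add_0_right by (rule fps_ext, subst nested_geo_series_step) simp
qed

lemma chain_has_sum_nested_geo:
  "((\<lambda>l. (geo l * nested_geo p l) $ r * beta_nat a l) has_sum chain 0 r a $ p) UNIV"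
  using has_sum_nested_geo_series chain_eq_nested_geo_series by simp

subsection \<open>Iterated tail sums\<close>

lemma has_sum_sum:
  fixes f :: "'i \<Rightarrow> 'a \<Rightarrow> real"
  assumes "\<And>i. i \<in> I \<Longrightarrow> (f i has_sum s i) A"
  shows "((\<lambda>x. \<Sum>i\<in>I. f i x) has_sum (\<Sum>i\<in>I. s i)) A"
  using assms by (induction I rule: infinite_finite_induct) (auto intro: has_sum_add)

lemma has_sum_SigmaI_nonneg:
  fixes f :: "'a \<times> 'b \<Rightarrow> real"
  assumes "\<And>x. x \<in> A \<Longrightarrow> ((\<lambda>y. f (x, y)) has_sum g x) (B x)" "(g has_sum S) A"
    and "\<And>x y. x \<in> A \<Longrightarrow> y \<in> B x \<Longrightarrow> 0 \<le> f (x, y)"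
  shows "(f has_sum S) (Sigma A B)"
proof (rule has_sum_SigmaI[OF assms(1,2)])
  show "f summable_on Sigma A B"
    using summable_on_SigmaI[OF assms(1) has_sum_imp_summable[OF assms(2)] assms(3)] by blast
qed

lemma has_sum_tonelli:
  fixes g :: "'a \<Rightarrow> 'b \<Rightarrow> real"
  assumes "\<And>v. v \<in> A \<Longrightarrow> (g v has_sum F v) B" "(F has_sum V) A"
    and "\<And>l. l \<in> B \<Longrightarrow> ((\<lambda>v. g v l) has_sum G l) A"
    and "\<And>v l. v \<in> A \<Longrightarrow> l \<in> B \<Longrightarrow> 0 \<le> g v l"
  shows "(G has_sum V) B"
proof -
  have "((\<lambda>(v, l). g v l) has_sum V) (A \<times> B)"
    using assms by (intro has_sum_SigmaI_nonneg[where g = F]) auto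
  then have "((\<lambda>(l, v). g v l) has_sum V) (B \<times> A)"
    by (subst (asm) has_sum_swap) (simp add: case_prod_unfold)
  then show ?thesis
    by (rule has_sum_SigmaD) (use assms(3) in auto)
qed

definition tail :: "(nat \<Rightarrow> real) \<Rightarrow> nat \<Rightarrow> real" where
  "tail f a = (\<Sum>\<^sub>\<infinity>v\<in>{a<..}. inverse (real v) * f v)"

lemma tail_summable_and_decays:
  assumes "decays f"
  shows "(\<lambda>v. inverse (real v) * f v) summable_on {a<..}" "decays (tail f)"
proof -
  obtain C where C: "\<And>a. \<bar>f a\<bar> \<le> C / real (Suc a)"
    using assms by (auto simp: decays_def)
  have *: "\<bar>inverse (real v) * f v\<bar> \<le> C / (real v * real (Suc v))" for v
  proof -
    have "\<bar>inverse (real v) * f v\<bar> \<le> inverse (real v) * (C / real (Suc v))"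
      unfolding abs_mult by (intro mult_mono C) auto
    then show ?thesis by (simp add: divide_simps)
  qed
  show "(\<lambda>v. inverse (real v) * f v) summable_on {a<..}"
    by (rule tail_bound(1)[OF *])
  show "decays (tail f)"
    unfolding decays_def tail_def by (intro exI[of _ C] allI tail_bound(2)[OF *])
qed

lemma has_sum_tail:
  "decays f \<Longrightarrow> ((\<lambda>v. inverse (real v) * f v) has_sum tail f a) {a<..}"
  unfolding tail_def by (intro has_sum_infsum tail_summable_and_decays)

lemma decays_tail_iter: "decays f \<Longrightarrow> decays ((tail ^^ s) f)"
  by (induction s) (auto intro: tail_summable_and_decays)

lemma decays_shift:
  assumes "decays f"
  shows "decays (\<lambda>a. f (a + j))"
proof -
  obtain C where C: "\<And>a. \<bar>f a\<bar> \<le> C / real (Suc a)"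
    using assms by (auto simp: decays_def)
  have "0 \<le> C" using C[of 0] by simp
  have "\<bar>f (a + j)\<bar> \<le> C / real (Suc a)" for a
    by (rule order_trans[OF C]) (use \<open>0 \<le> C\<close> in \<open>auto intro!: divide_left_mono\<close>)
  then show ?thesis by (auto simp: decays_def)
qed

lemma decays_sum:
  assumes "\<And>j. j \<in> J \<Longrightarrow> decays (f j)"
  shows "decays (\<lambda>a. \<Sum>j\<in>J. c j * f j a)"
proof -
  have "\<forall>j\<in>J. \<exists>C. \<forall>a. \<bar>f j a\<bar> \<le> C / real (Suc a)"
    using assms by (auto simp: decays_def)
  then obtain C where C: "\<And>j a. j \<in> J \<Longrightarrow> \<bar>f j a\<bar> \<le> C j / real (Suc a)"
    by metis
  have "\<bar>\<Sum>j\<in>J. c j * f j a\<bar> \<le> (\<Sum>j\<in>J. \<bar>c j\<bar> * C j) / real (Suc a)" for a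
  proof -
    have "\<bar>\<Sum>j\<in>J. c j * f j a\<bar> \<le> (\<Sum>j\<in>J. \<bar>c j * f j a\<bar>)" by (rule sum_abs)
    also have "\<dots> \<le> (\<Sum>j\<in>J. \<bar>c j\<bar> * (C j / real (Suc a)))"
      unfolding abs_mult by (intro sum_mono mult_left_mono C) auto
    finally show ?thesis by (simp add: sum_divide_distrib)
  qed
  then show ?thesis by (auto simp: decays_def)
qed

lemma tail_sum:
  assumes "\<And>j. j \<in> J \<Longrightarrow> decays (f j)"
  shows "tail (\<lambda>a. \<Sum>j\<in>J. c j * f j a) = (\<lambda>a. \<Sum>j\<in>J. c j * tail (f j) a)"
proof
  fix a
  have "((\<lambda>v. \<Sum>j\<in>J. c j * (inverse (real v) * f j v)) has_sum (\<Sum>j\<in>J. c j * tail (f j) a)) {a<..}"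
    by (intro has_sum_sum has_sum_cmult_right has_sum_tail assms)
  then have "((\<lambda>v. inverse (real v) * (\<Sum>j\<in>J. c j * f j v)) has_sum (\<Sum>j\<in>J. c j * tail (f j) a)) {a<..}"
    by (simp add: sum_distrib_left mult_ac)
  then show "tail (\<lambda>a. \<Sum>j\<in>J. c j * f j a) a = (\<Sum>j\<in>J. c j * tail (f j) a)"
    unfolding tail_def[of "\<lambda>a. \<Sum>j\<in>J. c j * f j a"] by (rule infsumI)
qed

lemma tail_iter_sum:
  assumes "\<And>j. j \<in> J \<Longrightarrow> decays (f j)"
  shows "(tail ^^ s) (\<lambda>a. \<Sum>j\<in>J. c j * f j a) = (\<lambda>a. \<Sum>j\<in>J. c j * (tail ^^ s) (f j) a)"
proof (induction s)
  case (Suc s)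
  then show ?case using assms by (simp add: tail_sum decays_tail_iter)
qed simp

text \<open>Nonnegativity permits the interchange of T with the sum over \<open>l\<close>, so T acts
  on the kernel alone. For fixed \<open>l\<close> only v < l contributes, which gives the finite sum
  in \<open>kern_iter\<close>.\<close>

lemma tail_iter_kern:
  "((\<lambda>l. geo (l + m) $ q * (geo l * kern_iter s l b) $ r) has_sum (tail ^^ s) (\<lambda>a. chain m r a $ q) b) UNIV"
proof (induction s arbitrary: b)
  case 0
  show ?case using chain_has_sum_kern by simp
next
  case (Suc s)
  let ?F = "(tail ^^ s) (\<lambda>a. chain m r a $ q)"
  show ?case
  proof (rule has_sum_tonelli)
    show "((\<lambda>l. inverse (real v) * (geo (l + m) $ q * (geo l * kern_iter s l v) $ r))
        has_sum inverse (real v) * ?F v) UNIV" for v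
      by (intro has_sum_cmult_right Suc)
    show "((\<lambda>v. inverse (real v) * ?F v) has_sum (tail ^^ Suc s) (\<lambda>a. chain m r a $ q) b) {b<..}"
      by (simp add: has_sum_tail decays_tail_iter decays_chain)
    show "((\<lambda>v. inverse (real v) * (geo (l + m) $ q * (geo l * kern_iter s l v) $ r)) has_sum
        geo (l + m) $ q * (geo l * kern_iter (Suc s) l b) $ r) {b<..}" for l
    proof (rule has_sum_finite_neutralI[of "{b<..<l}"])
      show "inverse (real v) * (geo (l + m) $ q * (geo l * kern_iter s l v) $ r) = 0"
        if "v \<in> {b<..} - {b<..<l}" for v
        using that kern_iter_eq_0[of l v s] by (cases "l = 0") auto
      have "geo l * kern_iter (Suc s) l b = (\<Sum>v\<in>{b<..<l}. fps_const (inverse (real v)) * (geo l * kern_iter s l v))"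
        by (simp add: sum_distrib_left mult_ac)
      then have "(geo l * kern_iter (Suc s) l b) $ r = (\<Sum>v\<in>{b<..<l}. inverse (real v) * (geo l * kern_iter s l v) $ r)"
        by (simp only: fps_sum_nth fps_mult_left_const_nth)
      then show "geo (l + m) $ q * (geo l * kern_iter (Suc s) l b) $ r =
         (\<Sum>v\<in>{b<..<l}. inverse (real v) * (geo (l + m) $ q * (geo l * kern_iter s l v) $ r))"
        by (simp only: sum_distrib_left mult.left_commute)
    qed auto
    show "0 \<le> inverse (real v) * (geo (l + m) $ q * (geo l * kern_iter s l v) $ r)" for v l
      by (intro mult_nonneg_nonneg nonneg_fpsD nonneg_fps_mult nonneg_geo nonneg_kern_iter) auto
  qed
qed

text \<open>Pascal's rule: an alternating sum of order m + 1 is one of order \<open>m\<close> over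
  consecutive differences.\<close>

lemma alternating_sum_Suc:
  fixes f :: "nat \<Rightarrow> real"
  shows "(\<Sum>j=0..Suc m. (-1) ^ j * real (Suc m choose j) * f j)
    = (\<Sum>j=0..m. (-1) ^ j * real (m choose j) * (f j - f (Suc j)))"
proof -
  have "(\<Sum>j=0..m. (-1) ^ j * real (m choose j) * f j) = (\<Sum>j=0..Suc m. (-1) ^ j * real (m choose j) * f j)"
    by simp
  also have "\<dots> = f 0 + (\<Sum>j=0..m. (-1) ^ Suc j * real (m choose Suc j) * f (Suc j))"
    by (subst sum.atLeast0_atMost_Suc_shift) simp
  finally have "(\<Sum>j=0..m. (-1) ^ j * real (m choose j) * f j)
    = f 0 + (\<Sum>j=0..m. (-1) ^ Suc j * real (m choose Suc j) * f (Suc j))" .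
  moreover have "(\<Sum>j=0..Suc m. (-1) ^ j * real (Suc m choose j) * f j)
      = f 0 + (\<Sum>j=0..m. (-1) ^ Suc j * real (Suc m choose Suc j) * f (Suc j))"
    by (subst sum.atLeast0_atMost_Suc_shift) simp
  ultimately show ?thesis
    by (simp add: sum.distrib sum_subtractf sum_negf algebra_simps)
qed

text \<open>Under the Beta integral this expands (1 - t)^m; in the proof each of the
  \<open>m\<close> differences raises the second argument by one.\<close>

lemma alternating_sum_beta_nat:
  "0 < l \<Longrightarrow> (\<Sum>j=0..m. (-1) ^ j * real (m choose j) * beta_nat (a + j) l) = beta_nat a (l + m)"
proof (induction m arbitrary: l)
  case (Suc m)
  have "(\<Sum>j=0..Suc m. (-1) ^ j * real (Suc m choose j) * beta_nat (a + j) l)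
    = (\<Sum>j=0..m. (-1) ^ j * real (m choose j) * beta_nat (a + j) (Suc l))"
    unfolding alternating_sum_Suc add_Suc_right beta_nat_diff[OF Suc.prems] ..
  then show ?case using Suc.IH[of "Suc l"] by simp
qed simp

text \<open>The function B(a + 1, n) of \<open>a\<close> is an eigenfunction of T with eigenvalue
  1/n: by \<open>beta_nat_Suc\<close> and \<open>beta_nat_diff\<close> the summand is 1/n times a
  difference in \<open>v\<close>.\<close>

lemma tail_beta_nat_sum:
  assumes "0 < n"
  shows "((\<lambda>v. inverse (real v) * beta_nat v n) has_sum inverse (real n) * beta_nat b n) {b<..}"
proof (rule has_sum_telescope)
  have "(\<lambda>a. beta_nat a n) \<longlonglongrightarrow> 0"
  proof (rule tendsto_0_squeeze_abs)
    show "(\<lambda>a. (1 / real n) / real (Suc a)) \<longlonglongrightarrow> 0"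
      by (rule LIMSEQ_Suc[OF lim_const_over_n])
    show "\<bar>beta_nat a n\<bar> \<le> (1 / real n) / real (Suc a)" for a
      using beta_nat_le[OF assms, of a] beta_nat_nonneg[of a n] by simp
  qed
  then show "(\<lambda>a. inverse (real n) * beta_nat a n) \<longlonglongrightarrow> 0"
    by (rule tendsto_mult_right_zero)
  show "inverse (real (Suc v)) * beta_nat (Suc v) n = inverse (real n) * beta_nat v n - inverse (real n) * beta_nat (Suc v) n" for v
    using beta_nat_Suc[OF assms, of v] assms
    unfolding right_diff_distrib[symmetric] beta_nat_diff[OF assms] by (simp add: divide_simps mult_ac del: of_nat_Suc)
qed (simp add: beta_nat_nonneg)

text \<open>The alternating sum is evaluated before T is applied. It turns B(a + 1, l) into the
  eigenfunction B(a + 1, l + m) and leaves nonnegative terms for the interchange; each T then costs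
  a factor 1/(l + m).\<close>

lemma tail_iter_nested_geo:
  fixes m p r
  defines "D \<equiv> (\<lambda>a. \<Sum>j=0..m. (-1) ^ j * real (m choose j) * chain 0 r (a + j) $ p)"
  shows "((\<lambda>l. (geo l * nested_geo p l) $ r * (inverse (real (l + m)) ^ s * beta_nat b (l + m))) has_sum (tail ^^ s) D b) UNIV"
proof (induction s arbitrary: b)
  case 0
  have "((\<lambda>l. \<Sum>j=0..m. (-1) ^ j * real (m choose j) * ((geo l * nested_geo p l) $ r * beta_nat (b + j) l)) has_sum D b) UNIV"
    unfolding D_def by (intro has_sum_sum has_sum_cmult_right chain_has_sum_nested_geo)
  moreover have "(\<Sum>j=0..m. (-1) ^ j * real (m choose j) * ((geo l * nested_geo p l) $ r * beta_nat (b + j) l))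
     = (geo l * nested_geo p l) $ r * beta_nat b (l + m)" for l
  proof (cases "l = 0")
    case False
    then have "beta_nat b (l + m) = (\<Sum>j=0..m. (-1) ^ j * real (m choose j) * beta_nat (b + j) l)"
      by (simp add: alternating_sum_beta_nat)
    then show ?thesis by (simp add: sum_distrib_left mult_ac)
  qed simp
  ultimately show ?case by simp
next
  case (Suc s)
  have D: "decays D"
    unfolding D_def by (intro decays_sum decays_shift[of "\<lambda>a. chain 0 r a $ p"] decays_chain)
  let ?F = "(tail ^^ s) D"
  show ?case
  proof (rule has_sum_tonelli)
    show "((\<lambda>l. inverse (real v) * ((geo l * nested_geo p l) $ r * (inverse (real (l + m)) ^ s * beta_nat v (l + m))))
        has_sum inverse (real v) * ?F v) UNIV" for v
      by (intro has_sum_cmult_right Suc)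
    show "((\<lambda>v. inverse (real v) * ?F v) has_sum (tail ^^ Suc s) D b) {b<..}"
      by (simp add: has_sum_tail decays_tail_iter D)
    show "((\<lambda>v. inverse (real v) * ((geo l * nested_geo p l) $ r * (inverse (real (l + m)) ^ s * beta_nat v (l + m)))) has_sum
        (geo l * nested_geo p l) $ r * (inverse (real (l + m)) ^ Suc s * beta_nat b (l + m))) {b<..}" for l
    proof (cases "l = 0")
      case False
      then have "((\<lambda>v. ((geo l * nested_geo p l) $ r * inverse (real (l + m)) ^ s) * (inverse (real v) * beta_nat v (l + m)))
        has_sum ((geo l * nested_geo p l) $ r * inverse (real (l + m)) ^ s) * (inverse (real (l + m)) * beta_nat b (l + m))) {b<..}"
        by (intro has_sum_cmult_right tail_beta_nat_sum) simp
      then show ?thesis by (simp add: mult_ac)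
    qed simp
    show "0 \<le> inverse (real v) * ((geo l * nested_geo p l) $ r * (inverse (real (l + m)) ^ s * beta_nat v (l + m)))" for v l
      by (intro mult_nonneg_nonneg nonneg_fpsD nonneg_fps_mult nonneg_geo nonneg_nested_geo beta_nat_nonneg zero_le_power) auto
  qed
qed

lemma nested_geo_sum_eq_tail_iter_chain:
  "((\<lambda>l. geo (l + m) $ q * (geo l * nested_geo p l) $ r) has_sum (tail ^^ p) (\<lambda>a. chain m r a $ q) 0) UNIV"
  using tail_iter_kern[of m q p 0 r] by (simp add: kern_iter_nested_geo)

text \<open>At 0 the Beta value is 1/(l + m), which with \<open>q\<close> eigenvalue factors makes
  \<open>geo (l + m) $ q\<close>. Both expansions thus give the same series over \<open>l\<close>,
  and linearity of T moves the alternating sum outside.\<close>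

lemma tail_iter_chain_alternating:
  "(tail ^^ p) (\<lambda>a. chain m r a $ q) 0
   = (\<Sum>j=0..m. (-1) ^ j * real (m choose j) * (tail ^^ q) (\<lambda>a. chain 0 r (a + j) $ p) 0)"
proof -
  have *: "(geo l * nested_geo p l) $ r * (inverse (real (l + m)) ^ q * beta_nat 0 (l + m))
      = geo (l + m) $ q * (geo l * nested_geo p l) $ r" for l
    by (cases "l = 0") (simp_all add: beta_nat_0 geo_nth)
  have "((\<lambda>l. geo (l + m) $ q * (geo l * nested_geo p l) $ r) has_sum
    (tail ^^ q) (\<lambda>a. \<Sum>j=0..m. (-1) ^ j * real (m choose j) * chain 0 r (a + j) $ p) 0) UNIV"
    using tail_iter_nested_geo[where m = m and p = p and r = r and s = q and b = 0] unfolding * .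
  then have "(tail ^^ p) (\<lambda>a. chain m r a $ q) 0 =
    (tail ^^ q) (\<lambda>a. \<Sum>j=0..m. (-1) ^ j * real (m choose j) * chain 0 r (a + j) $ p) 0"
    using nested_geo_sum_eq_tail_iter_chain has_sum_unique by blast
  also have "(tail ^^ q) (\<lambda>a. \<Sum>j=0..m. (-1) ^ j * real (m choose j) * chain 0 r (a + j) $ p)
    = (\<lambda>a. \<Sum>j=0..m. (-1) ^ j * real (m choose j) * (tail ^^ q) (\<lambda>a. chain 0 r (a + j) $ p) a)"
    by (rule tail_iter_sum) (rule decays_shift[OF decays_chain])
  finally show ?thesis .
qed

subsection \<open>Sums over compositions and increasing tuples\<close>

lemma finite_compositions: "finite (compositions n w)"
proof (rule finite_subset)
  show "compositions n w \<subseteq> {1..n} \<rightarrow>\<^sub>E {..w}"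
  proof
    fix \<alpha> assume \<alpha>: "\<alpha> \<in> compositions n w"
    then have "\<alpha> i \<le> w" if "i \<in> {1..n}" for i
      using that member_le_sum[of i "{1..n}" \<alpha>] by (auto simp: compositions_def)
    with \<alpha> show "\<alpha> \<in> {1..n} \<rightarrow>\<^sub>E {..w}"
      by (auto simp: compositions_def PiE_iff)
  qed
qed (intro finite_PiE; simp)

lemma sum_fun_upd_Suc: "(\<Sum>i=1..n. (f(Suc n := x)) i) = (\<Sum>i=1..n. f i)"
  by (intro sum.cong) auto

lemma prod_fun_upd_Suc: "(\<Prod>i=1..n. F i ((f(Suc n := x)) i)) = (\<Prod>i=1..n. F i (f i))"
  by (intro prod.cong) auto

text \<open>Splits off the last part. The index \<open>i\<close> is the excess of the weight over
  the number of parts, so that it matches the coefficient index in a Cauchy product.\<close>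

lemma compositions_Suc_bij:
  "bij_betw (\<lambda>(i, \<alpha>). \<alpha>(Suc n := Suc (r - i))) (Sigma {0..r} (\<lambda>i. compositions n (n + i)))
    (compositions (Suc n) (Suc n + r))"
proof (rule bij_betwI[where g = "\<lambda>\<beta>. ((\<Sum>i=1..n. \<beta> i) - n, restrict \<beta> {1..n})"])
  show "(\<lambda>(i, \<alpha>). \<alpha>(Suc n := Suc (r - i))) \<in> Sigma {0..r} (\<lambda>i. compositions n (n + i)) \<rightarrow> compositions (Suc n) (Suc n + r)"
    by (auto simp: compositions_def PiE_iff extensional_def sum_fun_upd_Suc)
  show "(\<lambda>\<beta>. ((\<Sum>i=1..n. \<beta> i) - n, restrict \<beta> {1..n})) \<in> compositions (Suc n) (Suc n + r)
      \<rightarrow> Sigma {0..r} (\<lambda>i. compositions n (n + i))"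
  proof
    fix \<beta> assume "\<beta> \<in> compositions (Suc n) (Suc n + r)"
    then have \<beta>: "\<And>i. i \<in> {1..Suc n} \<Longrightarrow> 1 \<le> \<beta> i" "(\<Sum>i=1..n. \<beta> i) + \<beta> (Suc n) = Suc n + r"
      by (auto simp: compositions_def PiE_iff)
    have "n \<le> (\<Sum>i=1..n. \<beta> i)"
      using sum_mono[of "{1..n}" "\<lambda>_. 1" \<beta>] \<beta>(1) by simp
    moreover have "1 \<le> \<beta> (Suc n)" by (rule \<beta>(1)) simp
    ultimately have "(\<Sum>i=1..n. \<beta> i) - n \<le> r" "n + ((\<Sum>i=1..n. \<beta> i) - n) = (\<Sum>i=1..n. \<beta> i)"
      using \<beta>(2) by linarith+
    then show "((\<Sum>i=1..n. \<beta> i) - n, restrict \<beta> {1..n}) \<in> Sigma {0..r} (\<lambda>i. compositions n (n + i))"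
      using \<beta> by (auto simp: compositions_def)
  qed
  show "(\<lambda>\<beta>. ((\<Sum>i=1..n. \<beta> i) - n, restrict \<beta> {1..n})) ((\<lambda>(i, \<alpha>). \<alpha>(Suc n := Suc (r - i))) x) = x"
    if "x \<in> Sigma {0..r} (\<lambda>i. compositions n (n + i))" for x
    using that by (auto simp: compositions_def sum_fun_upd_Suc fun_eq_iff PiE_iff extensional_def restrict_def)
  show "(\<lambda>(i, \<alpha>). \<alpha>(Suc n := Suc (r - i))) ((\<lambda>\<beta>. ((\<Sum>i=1..n. \<beta> i) - n, restrict \<beta> {1..n})) \<beta>) = \<beta>"
    if "\<beta> \<in> compositions (Suc n) (Suc n + r)" for \<beta>
  proof -
    have \<beta>: "\<And>i. i \<in> {1..Suc n} \<Longrightarrow> 1 \<le> \<beta> i" "(\<Sum>i=1..n. \<beta> i) + \<beta> (Suc n) = Suc n + r"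
      "\<beta> \<in> extensional {1..Suc n}"
      using that by (auto simp: compositions_def PiE_iff)
    have "n \<le> (\<Sum>i=1..n. \<beta> i)"
      using sum_mono[of "{1..n}" "\<lambda>_. 1" \<beta>] \<beta>(1) by simp
    with \<beta>(1)[of "Suc n"] \<beta>(2) have "Suc (r - ((\<Sum>i=1..n. \<beta> i) - n)) = \<beta> (Suc n)" by simp
    with \<beta>(3) show ?thesis by (auto simp: fun_eq_iff extensional_def restrict_def)
  qed
qed

text \<open>Compositions are generated by a product of geometric series; the weight n + r absorbs
  the exponent s + 1 in the coefficients of \<open>geo\<close>.\<close>

lemma sum_compositions_geo:
  "(\<Sum>\<alpha>\<in>compositions n (n + r). \<Prod>i=1..n. inverse (real (v i)) ^ \<alpha> i) = (\<Prod>i=1..n. geo (v i)) $ r"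
proof (induction n arbitrary: r)
  case 0
  have "compositions 0 (0 + r) = (if r = 0 then {\<lambda>_. undefined} else {})"
    by (auto simp: compositions_def)
  then show ?case by (simp add: fps_one_nth)
next
  case (Suc n)
  let ?f = "\<lambda>n \<alpha>. \<Prod>i=1..n. inverse (real (v i)) ^ \<alpha> i"
  have "(\<Sum>\<alpha>\<in>compositions (Suc n) (Suc n + r). ?f (Suc n) \<alpha>)
     = (\<Sum>x\<in>Sigma {0..r} (\<lambda>i. compositions n (n + i)). ?f (Suc n) ((\<lambda>(i, \<alpha>). \<alpha>(Suc n := Suc (r - i))) x))"
    by (rule sum.reindex_bij_betw[OF compositions_Suc_bij, symmetric])
  also have "\<dots> = (\<Sum>(i, \<alpha>)\<in>Sigma {0..r} (\<lambda>i. compositions n (n + i)). ?f n \<alpha> * geo (v (Suc n)) $ (r - i))"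
    by (intro sum.cong) (auto simp: prod_fun_upd_Suc[of "\<lambda>i x. inverse (real (v i)) ^ x"] geo_nth)
  also have "\<dots> = (\<Sum>i=0..r. \<Sum>\<alpha>\<in>compositions n (n + i). ?f n \<alpha> * geo (v (Suc n)) $ (r - i))"
    by (rule sum.Sigma[symmetric]) (auto simp: finite_compositions)
  also have "\<dots> = (\<Sum>i=0..r. (\<Prod>i=1..n. geo (v i)) $ i * geo (v (Suc n)) $ (r - i))"
    by (simp only: Suc[symmetric] sum_distrib_right)
  finally show ?case by (simp add: fps_mult_nth)
qed

text \<open>The value 0 for the empty tuple lets the first entry range over all positive
  integers.\<close>

definition last_entry :: "nat \<Rightarrow> (nat \<Rightarrow> nat) \<Rightarrow> nat" where
  "last_entry n k = (if n = 0 then 0 else k n)"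

lemma increasing_tuples_0: "increasing_tuples 0 = {\<lambda>_. undefined}"
  by (auto simp: increasing_tuples_def)

lemma increasing_tuples_Suc_bij:
  "bij_betw (\<lambda>(k, v). k(Suc n := v)) (Sigma (increasing_tuples n) (\<lambda>k. {last_entry n k<..}))
    (increasing_tuples (Suc n))"
proof (rule bij_betwI[where g = "\<lambda>k. (restrict k {1..n}, k (Suc n))"])
  show "(\<lambda>(k, v). k(Suc n := v)) \<in> Sigma (increasing_tuples n) (\<lambda>k. {last_entry n k<..}) \<rightarrow> increasing_tuples (Suc n)"
  proof
    fix x assume "x \<in> Sigma (increasing_tuples n) (\<lambda>k. {last_entry n k<..})"
    then obtain k v where x: "x = (k, v)" and k: "k \<in> {1..n} \<rightarrow>\<^sub>E {1..}" "strict_mono_on {1..n} k"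
      and v: "last_entry n k < v"
      by (auto simp: increasing_tuples_def)
    have "k i < v" if "i \<in> {1..n}" for i
      using strict_mono_onD[OF k(2), of i n] v that by (cases "i = n") (auto simp: last_entry_def)
    with k(2) have "strict_mono_on {1..Suc n} (k(Suc n := v))"
      by (auto simp: strict_mono_on_def le_Suc_eq)
    with k(1) v show "(case x of (k, v) \<Rightarrow> k(Suc n := v)) \<in> increasing_tuples (Suc n)"
      by (auto simp: increasing_tuples_def x PiE_iff extensional_def)
  qed
  show "(\<lambda>k. (restrict k {1..n}, k (Suc n))) \<in> increasing_tuples (Suc n) \<rightarrow> Sigma (increasing_tuples n) (\<lambda>k. {last_entry n k<..})"
  proof
    fix k assume "k \<in> increasing_tuples (Suc n)"
    then have k: "k \<in> {1..Suc n} \<rightarrow>\<^sub>E {1..}" "strict_mono_on {1..Suc n} k"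
      by (auto simp: increasing_tuples_def)
    have "strict_mono_on {1..n} (restrict k {1..n})"
      using k(2) by (auto simp: strict_mono_on_def)
    moreover have "last_entry n (restrict k {1..n}) < k (Suc n)"
      using k(1) strict_mono_onD[OF k(2), of n "Suc n"] by (auto simp: last_entry_def PiE_iff Suc_le_eq)
    ultimately show "(restrict k {1..n}, k (Suc n)) \<in> Sigma (increasing_tuples n) (\<lambda>k. {last_entry n k<..})"
      using k(1) by (auto simp: increasing_tuples_def)
  qed
  show "(\<lambda>k. (restrict k {1..n}, k (Suc n))) ((\<lambda>(k, v). k(Suc n := v)) x) = x"
    if "x \<in> Sigma (increasing_tuples n) (\<lambda>k. {last_entry n k<..})" for x
    using that by (auto simp: increasing_tuples_def fun_eq_iff PiE_iff extensional_def restrict_def)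
  show "(\<lambda>(k, v). k(Suc n := v)) ((\<lambda>k. (restrict k {1..n}, k (Suc n))) k) = k"
    if "k \<in> increasing_tuples (Suc n)" for k
    using that by (auto simp: increasing_tuples_def fun_eq_iff PiE_iff extensional_def restrict_def)
qed

text \<open>Here \<open>h i a\<close> is the sum over the entries after the \<open>i\<close>-th,
  given that this one is \<open>a\<close>. Peeling off one entry at a time keeps the total equal to
  \<open>h 0 0\<close>, and nonnegativity joins the iterated sums into one over tuples.\<close>

lemma has_sum_increasing_tuples:
  assumes step: "\<And>i a q. i < n \<Longrightarrow> ((\<lambda>v. (g (Suc i) v * h (Suc i) v) $ q) has_sum h i a $ q) {a<..}"
    and nonneg: "\<And>i v. nonneg_fps (g i v)" "\<And>i v. nonneg_fps (h i v)"
  shows "i \<le> n \<Longrightarrow> ((\<lambda>k. ((\<Prod>j=1..i. g j (k j)) * h i (last_entry i k)) $ q) has_sum h 0 0 $ q) (increasing_tuples i)"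
proof (induction i arbitrary: q)
  case 0
  show ?case by (rule has_sum_finiteI) (simp_all add: increasing_tuples_0 last_entry_def)
next
  case (Suc i)
  let ?P = "\<lambda>k. \<Prod>j=1..i. g j (k j)"
  have "((\<lambda>(k, v). (?P k * (g (Suc i) v * h (Suc i) v)) $ q) has_sum h 0 0 $ q)
     (Sigma (increasing_tuples i) (\<lambda>k. {last_entry i k<..}))"
  proof (rule has_sum_SigmaI_nonneg)
    show "((\<lambda>k. (?P k * h i (last_entry i k)) $ q) has_sum h 0 0 $ q) (increasing_tuples i)"
      using Suc by simp
    show "((\<lambda>v. case (k, v) of (k, v) \<Rightarrow> (?P k * (g (Suc i) v * h (Suc i) v)) $ q)
        has_sum (?P k * h i (last_entry i k)) $ q) {last_entry i k<..}" for k
      unfolding prod.case fps_mult_nth[of "?P k"]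
      using Suc.prems by (intro has_sum_sum has_sum_cmult_right step) simp
    show "0 \<le> (case (k, v) of (k, v) \<Rightarrow> (?P k * (g (Suc i) v * h (Suc i) v)) $ q)" for k v
      unfolding prod.case by (intro nonneg_fpsD nonneg_fps_mult nonneg_fps_prod nonneg)
  qed
  also have "(\<lambda>(k, v). (?P k * (g (Suc i) v * h (Suc i) v)) $ q) = (\<lambda>x.
      (\<lambda>k. ((\<Prod>j=1..Suc i. g j (k j)) * h (Suc i) (last_entry (Suc i) k)) $ q) ((\<lambda>(k, v). k(Suc i := v)) x))"
    by (auto simp: fun_eq_iff prod_fun_upd_Suc[of g] last_entry_def mult.assoc)
  finally show ?case
    by (subst (asm) has_sum_reindex_bij_betw[OF increasing_tuples_Suc_bij])
qed

text \<open>The initial parts of (n + 1)-tuples with last entry \<open>v\<close>; in (B) the largest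
  index is the outer variable, so tuples are split by it first.\<close>

definition below :: "nat \<Rightarrow> nat \<Rightarrow> (nat \<Rightarrow> nat) set" where
  "below n v = {k \<in> increasing_tuples n. last_entry n k < v}"

lemma below_bij:
  "bij_betw (\<lambda>(v, k). k(Suc n := v)) (Sigma {1..} (below n)) (increasing_tuples (Suc n))"
proof -
  have "bij_betw (\<lambda>(v, k). (k, v)) (Sigma {1..} (below n)) (Sigma (increasing_tuples n) (\<lambda>k. {last_entry n k<..}))"
    by (rule bij_betwI[where g = "\<lambda>(k, v). (v, k)"]) (auto simp: below_def)
  from bij_betw_trans[OF this increasing_tuples_Suc_bij] show ?thesis
    by (simp add: comp_def case_prod_unfold)
qed

lemma below_Suc_bij:
  "bij_betw (\<lambda>(v, k). k(Suc n := v)) (Sigma {1..<l} (below n)) (below (Suc n) l)"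
proof (rule bij_betw_subset[OF below_bij])
  show "Sigma {1..<l} (below n) \<subseteq> Sigma {1..} (below n)" by auto
  show "(\<lambda>(v, k). k(Suc n := v)) ` Sigma {1..<l} (below n) = below (Suc n) l"
  proof (intro equalityI subsetI)
    fix k assume "k \<in> (\<lambda>(v, k). k(Suc n := v)) ` Sigma {1..<l} (below n)"
    then obtain v k' where x: "(v, k') \<in> Sigma {1..} (below n)" "v < l" and k: "k = k'(Suc n := v)"
      by auto
    from bij_betw_apply[OF below_bij x(1)] x(2) show "k \<in> below (Suc n) l"
      by (simp add: k below_def last_entry_def)
  next
    fix k assume k: "k \<in> below (Suc n) l"
    then have "k \<in> (\<lambda>(v, k). k(Suc n := v)) ` Sigma {1..} (below n)"
      unfolding bij_betw_imp_surj_on[OF below_bij] by (simp add: below_def)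
    then obtain v k' where x: "(v, k') \<in> Sigma {1..} (below n)" and eq: "k = k'(Suc n := v)" by auto
    from k have "v < l" by (simp add: eq below_def last_entry_def)
    with x show "k \<in> (\<lambda>(v, k). k(Suc n := v)) ` Sigma {1..<l} (below n)"
      unfolding eq by (intro image_eqI[of _ _ "(v, k')"]) auto
  qed
qed

text \<open>Positivity of \<open>l\<close> matters at p = 0, where \<open>below 0 0\<close> is empty
  but \<open>nested_geo 0 0 = 1\<close>.\<close>

lemma sum_below_geo:
  "0 < l \<Longrightarrow> finite (below p l) \<and> (\<Sum>k\<in>below p l. \<Prod>j=1..p. geo (k j)) = nested_geo p l"
proof (induction p arbitrary: l)
  case 0
  then have "below 0 l = {\<lambda>_. undefined}"
    by (auto simp: below_def increasing_tuples_0 last_entry_def)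
  then show ?case by simp
next
  case (Suc p)
  have fin: "finite (Sigma {1..<l} (below p))" using Suc.IH by (intro finite_SigmaI) auto
  then have "finite (below (Suc p) l)" using bij_betw_finite[OF below_Suc_bij] by blast
  moreover have "(\<Sum>k\<in>below (Suc p) l. \<Prod>j=1..Suc p. geo (k j))
    = (\<Sum>(v, k)\<in>Sigma {1..<l} (below p). \<Prod>j=1..Suc p. geo ((k(Suc p := v)) j))"
    by (subst sum.reindex_bij_betw[OF below_Suc_bij, symmetric]) (simp add: case_prod_unfold)
  moreover have "\<dots> = (\<Sum>(v, k)\<in>Sigma {1..<l} (below p). geo v * (\<Prod>j=1..p. geo (k j)))"
    by (intro sum.cong) (auto simp: prod_fun_upd_Suc[of "\<lambda>_. geo"])
  moreover have "\<dots> = (\<Sum>v\<in>{1..<l}. \<Sum>k\<in>below p v. geo v * (\<Prod>j=1..p. geo (k j)))"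
    using Suc.IH by (intro sum.Sigma[symmetric]) auto
  moreover have "\<dots> = (\<Sum>v\<in>{1..<l}. geo v * nested_geo p v)"
    using Suc.IH by (intro sum.cong) (auto simp: sum_distrib_left[symmetric])
  moreover have "\<dots> = (\<Sum>v<l. geo v * nested_geo p v)"
    by (rule sum.mono_neutral_left) (auto simp: not_le)
  ultimately show ?case by simp
qed

lemma has_sum_increasing_tuples_nested_geo:
  "((\<lambda>k. geo (k (Suc p) + m) $ q * (\<Prod>j=1..Suc p. geo (k j)) $ r) has_sum
     (tail ^^ p) (\<lambda>a. chain m r a $ q) 0) (increasing_tuples (Suc p))"
proof -
  let ?V = "(tail ^^ p) (\<lambda>a. chain m r a $ q) 0"
  have "((\<lambda>(l, k). geo (l + m) $ q * (geo l * (\<Prod>j=1..p. geo (k j))) $ r) has_sum ?V) (Sigma {1..} (below p))"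
  proof (rule has_sum_SigmaI_nonneg)
    have "((\<lambda>l. geo (l + m) $ q * (geo l * nested_geo p l) $ r) has_sum ?V) UNIV"
      by (rule nested_geo_sum_eq_tail_iter_chain)
    also have "?this \<longleftrightarrow> ((\<lambda>l. geo (l + m) $ q * (geo l * nested_geo p l) $ r) has_sum ?V) {1..}"
      by (intro has_sum_cong_neutral) (auto simp: not_le)
    finally show "((\<lambda>l. geo (l + m) $ q * (geo l * nested_geo p l) $ r) has_sum ?V) {1..}" .
    show "((\<lambda>k. case (l, k) of (l, k) \<Rightarrow> geo (l + m) $ q * (geo l * (\<Prod>j=1..p. geo (k j))) $ r) has_sum
        geo (l + m) $ q * (geo l * nested_geo p l) $ r) (below p l)" if "l \<in> {1..}" for l
    proof (rule has_sum_finiteI)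
      show "finite (below p l)" using sum_below_geo[of l p] that by simp
      have "nested_geo p l = (\<Sum>k\<in>below p l. \<Prod>j=1..p. geo (k j))"
        using sum_below_geo[of l p] that by simp
      then show "geo (l + m) $ q * (geo l * nested_geo p l) $ r =
        (\<Sum>k\<in>below p l. case (l, k) of (l, k) \<Rightarrow> geo (l + m) $ q * (geo l * (\<Prod>j=1..p. geo (k j))) $ r)"
        by (simp add: sum_distrib_left fps_sum_nth)
    qed
    show "0 \<le> (case (l, k) of (l, k) \<Rightarrow> geo (l + m) $ q * (geo l * (\<Prod>j=1..p. geo (k j))) $ r)" for l k
      unfolding prod.case by (intro mult_nonneg_nonneg nonneg_fpsD nonneg_fps_mult nonneg_fps_prod nonneg_geo)
  qed
  also have "(\<lambda>(l, k). geo (l + m) $ q * (geo l * (\<Prod>j=1..p. geo (k j))) $ r) = (\<lambda>x.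
      (\<lambda>k. geo (k (Suc p) + m) $ q * (\<Prod>j=1..Suc p. geo (k j)) $ r) ((\<lambda>(v, k). k(Suc p := v)) x))"
    by (auto simp: fun_eq_iff prod_fun_upd_Suc[of "\<lambda>_. geo"] mult_ac)
  finally show ?thesis
    by (subst (asm) has_sum_reindex_bij_betw[OF below_bij])
qed

lemma prod_split_at:
  fixes G :: "nat \<Rightarrow> 'a::comm_monoid_mult"
  shows "(\<Prod>j=1..p+n. G j) = (\<Prod>j=1..p. G j) * (\<Prod>j=1..n. G (p + j))"
  by (induction n) (simp_all add: mult_ac)

text \<open>Common form of (A) and the inner sum of (C): \<open>c\<close> shifts the last r + 1
  entries and \<open>d\<close> the extra factor at the end. (A) has c = m and d = 0, while (C) has c
  = d = j.\<close>

lemma has_sum_increasing_tuples_tail_iter: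
  assumes 0: "\<And>a q. ((\<lambda>v. (geo (v + c) * fps_const (inverse (real (v + d)))) $ q) has_sum X 0 a $ q) {a<..}"
    and Suc: "\<And>r a q. ((\<lambda>v. (geo (v + c) * X r v) $ q) has_sum X (Suc r) a $ q) {a<..}"
    and nonneg: "\<And>r a. nonneg_fps (X r a)"
    and decays: "\<And>r q. decays (\<lambda>a. X r a $ q)"
  shows "((\<lambda>k. inverse (\<Prod>i=1..p. real (k i)) * inverse (real (k (p + r + 1) + d)) *
       (\<Prod>i=1..r+1. geo (k (p + i) + c)) $ q) has_sum (tail ^^ p) (\<lambda>a. X r a $ q) 0) (increasing_tuples (p + r + 1))"
proof -
  \<comment> \<open>The factors come in three kinds: the first \<open>p\<close> entries, the next
    \<open>r\<close>, and the last. The values of \<open>h\<close> are the sums still to be taken,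
    ending in 1 when no entry is left.\<close>
  define g where "g j v = (if j \<le> p then fps_const (inverse (real v)) else if j \<le> p + r then geo (v + c)
      else geo (v + c) * fps_const (inverse (real (v + d))))" for j v
  define h where "h i a = (if i \<le> p then Abs_fps (\<lambda>q. (tail ^^ (p - i)) (\<lambda>a. X r a $ q) a)
     else if i \<le> p + r then X (p + r - i) a else 1)" for i a
  have hp: "h i a = X (p + r - i) a" if "p \<le> i" "i \<le> p + r" for i a
    using that by (auto simp: h_def intro!: fps_ext)
  have tail_nonneg: "0 \<le> (tail ^^ s) (\<lambda>a. X r a $ q) a" for s q a
    by (induction s arbitrary: a) (auto simp: tail_def nonneg nonneg_fpsD intro!: infsum_nonneg)
  have "((\<lambda>k. ((\<Prod>j=1..p+r+1. g j (k j)) * h (p + r + 1) (last_entry (p + r + 1) k)) $ q) has_sum h 0 0 $ q)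
      (increasing_tuples (p + r + 1))"
  proof (rule has_sum_increasing_tuples[OF _ _ _ order_refl])
    show "nonneg_fps (g j v)" for j v
      by (auto simp: g_def intro!: nonneg_fps_const nonneg_fps_mult nonneg_geo)
    show "nonneg_fps (h j v)" for j v
      by (auto simp: h_def nonneg nonneg_fps_1) (auto simp: nonneg_fps_def tail_nonneg)
    show "((\<lambda>v. (g (Suc i) v * h (Suc i) v) $ q) has_sum h i a $ q) {a<..}" if i: "i < p + r + 1" for i a q
    proof -
      consider "i < p" | "p \<le> i" "i < p + r" | "i = p + r" using i by linarith
      then show ?thesis
      proof cases
        case 1
        then have "p - i = Suc (p - Suc i)" by simp
        then show ?thesis
          using 1 has_sum_tail[OF decays_tail_iter[OF decays[of r q], of "p - Suc i"], of a]
          by (simp add: g_def h_def)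
      next
        case 2
        then have "p + r - i = Suc (p + r - Suc i)" by simp
        then show ?thesis
          using 2 Suc[of "p + r - Suc i" q a] hp[of i a] hp[of "Suc i"] by (simp add: g_def)
      next
        case 3
        then show ?thesis using 0[of q a] hp[of i a] by (simp add: g_def h_def)
      qed
    qed
  qed
  moreover have "((\<Prod>j=1..p+r+1. g j (k j)) * h (p + r + 1) (last_entry (p + r + 1) k)) $ q =
      inverse (\<Prod>i=1..p. real (k i)) * inverse (real (k (p + r + 1) + d)) *
       (\<Prod>i=1..r+1. geo (k (p + i) + c)) $ q" for k
  proof -
    have "(\<Prod>j=1..p+r+1. g j (k j)) = (\<Prod>j=1..p. g j (k j)) * (\<Prod>j=1..r+1. g (p + j) (k (p + j)))"
      using prod_split_at[of "\<lambda>j. g j (k j)" p "r + 1"] by (simp only: add.assoc)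
    also have "(\<Prod>j=1..p. g j (k j)) = (\<Prod>j=1..p. fps_const (inverse (real (k j))))"
      by (intro prod.cong) (auto simp: g_def)
    also have "\<dots> = fps_const (inverse (\<Prod>i=1..p. real (k i)))"
      by (induction p) (simp_all add: mult_ac)
    also have "(\<Prod>j=1..r+1. g (p + j) (k (p + j))) = (\<Prod>j=1..r. g (p + j) (k (p + j))) * g (p + r + 1) (k (p + r + 1))"
      by simp
    also have "(\<Prod>j=1..r. g (p + j) (k (p + j))) = (\<Prod>j=1..r. geo (k (p + j) + c))"
      by (intro prod.cong) (auto simp: g_def)
    also have "(\<Prod>j=1..r. geo (k (p + j) + c)) * g (p + r + 1) (k (p + r + 1))
        = fps_const (inverse (real (k (p + r + 1) + d))) * (\<Prod>j=1..r+1. geo (k (p + j) + c))"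
      by (simp add: g_def mult_ac)
    finally show ?thesis by (simp add: h_def mult.assoc)
  qed
  moreover have "h 0 0 $ q = (tail ^^ p) (\<lambda>a. X r a $ q) 0" by (simp add: h_def)
  ultimately show ?thesis by simp
qed

section \<open>Evaluation of (A), (B) and (C)\<close>

lemma summable_on_summands:
  fixes f :: "'i \<Rightarrow> 'a \<Rightarrow> real"
  assumes "finite I" "\<And>i x. i \<in> I \<Longrightarrow> x \<in> S \<Longrightarrow> 0 \<le> f i x" "((\<lambda>x. \<Sum>i\<in>I. f i x) has_sum V) S"
  shows "\<forall>i\<in>I. f i summable_on S" "(\<Sum>i\<in>I. \<Sum>\<^sub>\<infinity>x\<in>S. f i x) = V"
proof -
  \<comment> \<open>All terms being nonnegative, each one is dominated by the whole finite
    sum.\<close>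
  show *: "\<forall>i\<in>I. f i summable_on S"
  proof
    fix i assume "i \<in> I"
    then show "f i summable_on S"
      using assms by (intro summable_on_comparison_test[OF has_sum_imp_summable[OF assms(3)]])
        (auto intro: member_le_sum)
  qed
  then have "((\<lambda>x. \<Sum>i\<in>I. f i x) has_sum (\<Sum>i\<in>I. \<Sum>\<^sub>\<infinity>x\<in>S. f i x)) S"
    by (intro has_sum_sum has_sum_infsum) auto
  with assms(3) show "(\<Sum>i\<in>I. \<Sum>\<^sub>\<infinity>x\<in>S. f i x) = V" by (metis has_sum_unique)
qed

lemma has_sum_greaterThan_shift:
  fixes f F :: "nat \<Rightarrow> real"
  assumes "\<And>a. (f has_sum F a) {a<..}"
  shows "((\<lambda>v. f (v + j)) has_sum F (a + j)) {a<..}"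
proof -
  have "((\<lambda>v. f (v + j)) has_sum F (a + j)) {a<..} \<longleftrightarrow> (f has_sum F (a + j)) {a + j<..}"
    by (rule has_sum_reindex_bij_witness[where i = "\<lambda>v. v - j" and j = "\<lambda>v. v + j"]) auto
  with assms show ?thesis by blast
qed

text \<open>The sum over compositions is first taken inside, where
  \<open>sum_compositions_geo\<close> makes it a coefficient; summability for each single
  composition is recovered from the total.\<close>

lemma
  fixes p q m r
  defines "V \<equiv> (tail ^^ p) (\<lambda>a. chain m r a $ q) 0"
  shows summable_A: "\<forall>\<alpha>\<in>compositions (r + 1) (q + r + 1). summand_A p m r \<alpha> summable_on increasing_tuples (p + r + 1)"
    and sum_A: "(\<Sum>\<alpha>\<in>compositions (r + 1) (q + r + 1). \<Sum>\<^sub>\<infinity>k\<in>increasing_tuples (p + r + 1). summand_A p m r \<alpha> k) = V"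
proof -
  have "((\<lambda>k. inverse (\<Prod>i=1..p. real (k i)) * inverse (real (k (p + r + 1) + 0)) *
       (\<Prod>i=1..r+1. geo (k (p + i) + m)) $ q) has_sum V) (increasing_tuples (p + r + 1))"
    unfolding V_def
  proof (rule has_sum_increasing_tuples_tail_iter)
    show "((\<lambda>v. (geo (v + m) * fps_const (inverse (real (v + 0)))) $ q) has_sum chain m 0 a $ q) {a<..}" for a q
      unfolding add_0_right by (rule has_sum_chain_0)
  qed (rule has_sum_chain_Suc nonneg_chain decays_chain)+
  moreover have "inverse (\<Prod>i=1..p. real (k i)) * inverse (real (k (p + r + 1) + 0)) *
       (\<Prod>i=1..r+1. geo (k (p + i) + m)) $ q = (\<Sum>\<alpha>\<in>compositions (r + 1) (q + r + 1). summand_A p m r \<alpha> k)" for k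
    using sum_compositions_geo[of "\<lambda>i. k (p + i) + m" "r + 1" q, symmetric]
    by (simp add: summand_A_def sum_distrib_left divide_inverse power_inverse prod_inversef[symmetric] comp_def add_ac mult_ac)
  ultimately have *: "((\<lambda>k. \<Sum>\<alpha>\<in>compositions (r + 1) (q + r + 1). summand_A p m r \<alpha> k) has_sum V) (increasing_tuples (p + r + 1))"
    by simp
  have "0 \<le> summand_A p m r \<alpha> k" for \<alpha> k
    unfolding summand_A_def by (intro divide_nonneg_nonneg prod_nonneg mult_nonneg_nonneg) (auto intro!: mult_nonneg_nonneg prod_nonneg)
  from summable_on_summands[OF finite_compositions this *]
  show "\<forall>\<alpha>\<in>compositions (r + 1) (q + r + 1). summand_A p m r \<alpha> summable_on increasing_tuples (p + r + 1)"
    "(\<Sum>\<alpha>\<in>compositions (r + 1) (q + r + 1). \<Sum>\<^sub>\<infinity>k\<in>increasing_tuples (p + r + 1). summand_A p m r \<alpha> k) = V" .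
qed

lemma
  fixes p q m r
  defines "V \<equiv> (tail ^^ p) (\<lambda>a. chain m r a $ q) 0"
  shows summable_B: "\<forall>\<beta>\<in>compositions (p + 1) (p + r + 1). summand_B p q m \<beta> summable_on increasing_tuples (p + 1)"
    and sum_B: "(\<Sum>\<beta>\<in>compositions (p + 1) (p + r + 1). \<Sum>\<^sub>\<infinity>l\<in>increasing_tuples (p + 1). summand_B p q m \<beta> l) = V"
proof -
  have "geo (k (Suc p) + m) $ q * (\<Prod>j=1..Suc p. geo (k j)) $ r =
      (\<Sum>\<beta>\<in>compositions (p + 1) (p + r + 1). summand_B p q m \<beta> k)" for k
    using sum_compositions_geo[of k "Suc p" r, symmetric]
    by (simp add: summand_B_def sum_distrib_left power_inverse geo_nth mult_ac)
  with has_sum_increasing_tuples_nested_geo[of p m q r]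
  have *: "((\<lambda>k. \<Sum>\<beta>\<in>compositions (p + 1) (p + r + 1). summand_B p q m \<beta> k) has_sum V) (increasing_tuples (p + 1))"
    by (simp add: V_def)
  have "0 \<le> summand_B p q m \<beta> k" for \<beta> k
    unfolding summand_B_def by (intro prod_nonneg mult_nonneg_nonneg) auto
  from summable_on_summands[OF finite_compositions this *]
  show "\<forall>\<beta>\<in>compositions (p + 1) (p + r + 1). summand_B p q m \<beta> summable_on increasing_tuples (p + 1)"
    "(\<Sum>\<beta>\<in>compositions (p + 1) (p + r + 1). \<Sum>\<^sub>\<infinity>l\<in>increasing_tuples (p + 1). summand_B p q m \<beta> l) = V" .
qed

text \<open>Compared with (A), \<open>p\<close> and \<open>q\<close> exchange roles, and
  \<open>chain\<close> with m = 0 is evaluated at a + j. The extra factor 1/(l + j) accounts for the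
  additional 1 in the last exponent.\<close>

lemma
  fixes p q j r
  defines "V \<equiv> (tail ^^ q) (\<lambda>a. chain 0 r (a + j) $ p) 0"
  shows summable_C: "\<forall>\<beta>\<in>compositions (r + 1) (p + r + 1). summand_C q r j \<beta> summable_on increasing_tuples (q + r + 1)"
    and sum_C: "(\<Sum>\<beta>\<in>compositions (r + 1) (p + r + 1). \<Sum>\<^sub>\<infinity>l\<in>increasing_tuples (q + r + 1). summand_C q r j \<beta> l) = V"
proof -
  have "((\<lambda>k. inverse (\<Prod>i=1..q. real (k i)) * inverse (real (k (q + r + 1) + j)) *
       (\<Prod>i=1..r+1. geo (k (q + i) + j)) $ p) has_sum V) (increasing_tuples (q + r + 1))"
    unfolding V_def
  proof (rule has_sum_increasing_tuples_tail_iter)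
    show "((\<lambda>v. (geo (v + j) * fps_const (inverse (real (v + j)))) $ p) has_sum chain 0 0 (a + j) $ p) {a<..}" for a p
      using has_sum_chain_0[of 0 p] by (intro has_sum_greaterThan_shift) simp
    show "((\<lambda>v. (geo (v + j) * chain 0 r (v + j)) $ p) has_sum chain 0 (Suc r) (a + j) $ p) {a<..}" for r a p
      using has_sum_chain_Suc[of 0 r p]
      by (intro has_sum_greaterThan_shift[where f = "\<lambda>v. (geo v * chain 0 r v) $ p" and F = "\<lambda>a. chain 0 (Suc r) a $ p"]) simp
    show "decays (\<lambda>a. chain 0 r (a + j) $ p)" for r p
      by (rule decays_shift[OF decays_chain])
  qed (rule nonneg_chain)
  moreover have "inverse (\<Prod>i=1..q. real (k i)) * inverse (real (k (q + r + 1) + j)) *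
       (\<Prod>i=1..r+1. geo (k (q + i) + j)) $ p = (\<Sum>\<beta>\<in>compositions (r + 1) (p + r + 1). summand_C q r j \<beta> k)" for k
    using sum_compositions_geo[of "\<lambda>i. k (q + i) + j" "r + 1" p, symmetric]
    by (simp add: summand_C_def sum_distrib_left power_inverse add_ac mult_ac)
  ultimately have *: "((\<lambda>k. \<Sum>\<beta>\<in>compositions (r + 1) (p + r + 1). summand_C q r j \<beta> k) has_sum V) (increasing_tuples (q + r + 1))"
    by simp
  have "0 \<le> summand_C q r j \<beta> k" for \<beta> k
    unfolding summand_C_def by (intro mult_nonneg_nonneg prod_nonneg) (auto intro!: prod_nonneg)
  from summable_on_summands[OF finite_compositions this *]
  show "\<forall>\<beta>\<in>compositions (r + 1) (p + r + 1). summand_C q r j \<beta> summable_on increasing_tuples (q + r + 1)"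
    "(\<Sum>\<beta>\<in>compositions (r + 1) (p + r + 1). \<Sum>\<^sub>\<infinity>l\<in>increasing_tuples (q + r + 1). summand_C q r j \<beta> l) = V" .
qed

theorem theorem3p1:
  fixes p q m r :: nat
  shows
    "(\<forall>\<alpha>\<in>compositions (r + 1) (q + r + 1).
        summand_A p m r \<alpha> summable_on increasing_tuples (p + r + 1)) \<and>
     (\<forall>\<beta>\<in>compositions (p + 1) (p + r + 1).
        summand_B p q m \<beta> summable_on increasing_tuples (p + 1)) \<and>
     (\<forall>j\<in>{0..m}. \<forall>\<beta>\<in>compositions (r + 1) (p + r + 1).
        summand_C q r j \<beta> summable_on increasing_tuples (q + r + 1)) \<and>
     (\<Sum>\<alpha>\<in>compositions (r + 1) (q + r + 1).
        \<Sum>\<^sub>\<infinity>k\<in>increasing_tuples (p + r + 1). summand_A p m r \<alpha> k)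
     = (\<Sum>\<beta>\<in>compositions (p + 1) (p + r + 1).
          \<Sum>\<^sub>\<infinity>l\<in>increasing_tuples (p + 1). summand_B p q m \<beta> l) \<and>
     (\<Sum>\<beta>\<in>compositions (p + 1) (p + r + 1).
        \<Sum>\<^sub>\<infinity>l\<in>increasing_tuples (p + 1). summand_B p q m \<beta> l)
     = (\<Sum>j=0..m. (-1) ^ j * real (m choose j) *
          (\<Sum>\<beta>\<in>compositions (r + 1) (p + r + 1).
             \<Sum>\<^sub>\<infinity>l\<in>increasing_tuples (q + r + 1). summand_C q r j \<beta> l))"
  \<comment> \<open>(A) and (B) rewrite to the same value, so the only equality left is the
    alternating one.\<close>
  unfolding sum_A sum_B sum_C
  using summable_A summable_B summable_C tail_iter_chain_alternating by blast

end
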